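(* Let $\{X_k\}$ and $\{\mu_k\}$ be the (infinite) sequences generated by the algorithm SRGD (described in the context, run without a stopping criterion), and let $\mathcal{A}:=\{k\in\mathbb{N}:\mu_{k+1}\neq\mu_k\}$. Then any accumulation point of the sequence $\{X_k:k\in\mathcal{A}\}$ is a first-order stationary point of the problem $\min\{F(X): X\in\mathbb{R}^{n\times p},\ X^\top X=I_p\}$, where $F(X)=f(BX)+h(X)$.
   Context: Setting. $p\le n$; $B\in\mathbb{R}^{q\times n}$ with $B\neq 0$; $f:\mathbb{R}^{q\times p}\to\mathbb{R}$ is convex, nonsmooth (not assumed differentiable) and Lipschitz continuous with constant $L_f$; $h:\mathbb{R}^{n\times p}\to\mathbb{R}$ is smooth, possibly nonconvex, and $\nabla h$ is Lipschitz continuous with constant $L_h$. $F(X):=f(BX)+h(X)$. $\mathcal{S}_{n,p}:=\{X\in\mathbb{R}^{n\times p}:X^\top X=I_p\}$ is the Stiefel manifold. $\|\cdot\|_F$ and $\|\cdot\|_2$ are the Frobenius and spectral norms. Stationarity. The tangent space is $\mathcal{T}_X\mathcal{S}_{n,p}=\{Y\in\mathbb{R}^{n\times p}:Y^\top X+X^\top Y=0\}$, and orthogonal projection onto it is $\mathrm{Proj}_{\mathcal{T}_X\mathcal{S}_{n,p}}(Y)=(I_n-XX^\top)Y+\frac12X(X^\top Y-Y^\top X)$. $\partial F(X)$ is the Clarke subdifferential of $F$ at $X$; here $\partial F(X)=B^\top\partial f(BX)+\nabla h(X)$, with $\partial f$ the convex subdifferential. $X\in\mathcal{S}_{n,p}$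 is a first-order stationary point if $0\in\mathrm{Proj}_{\mathcal{T}_X\mathcal{S}_{n,p}}(\partial F(X))$. Smoothing. For $\mu>0$, $\mathrm{env}_f(Z,\mu):=\min_{Y\in\mathbb{R}^{q\times p}}\{f(Y)+\frac1{2\mu}\|Y-Z\|_F^2\}$ and $\tilde F(X,\mu):=\mathrm{env}_f(BX,\mu)+h(X)$. Put $L_0:=\|B\|_2^2$, $L_\mu:=L_0/\mu+L_h$, $\kappa:=L_f^2/2$. Retraction (polar decomposition): $\mathrm{Retr}_X(\xi)=(X+\xi)(I_p+\xi^\top\xi)^{-1/2}$ for $X\in\mathcal{S}_{n,p}$, $\xi\in\mathcal{T}_X\mathcal{S}_{n,p}$. Algorithm SRGD. Input: $X_0\in\mathcal{S}_{n,p}$, $\mu_{-1}=\mu_0>0$, $\sigma\in(0,1)$, $\alpha>0$, $\eta\in(0,1)$. For $k=0,1,2,\dots$: (1) Compute $V_k=(I_n-X_kX_k^\top)\nabla_X\tilde F(X_k,\mu_k)+\frac12X_k\big(X_k^\top\nabla_X\tilde F(X_k,\mu_k)-\nabla_X\tilde F(X_k,\mu_k)^\top X_k\big)$ and set $\tau_k=L_{\mu_k}^{-1}$. (2) Line search: compute $X_{k+1}=\mathrm{Retr}_{X_k}(-\tau_kV_k)$. If $\tilde F(X_{k+1},\mu_k)\le\tilde F(X_k,\mu_k)-\frac{\tau_k}2\|V_k\|_F^2$, go to (3); otherwise replace $\tau_k$ by $\eta\tau_k$ and repeat (2). (3) If $\tilde F(X_{k+1},\mu_k)+\kappa\mu_k-\tilde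 F(X_k,\mu_{k-1})-\kappa\mu_{k-1}\le-\alpha\mu_k^2$, set $\mu_{k+1}=\mu_k$; otherwise set $\mu_{k+1}=\mu_0/(k+1)^\sigma$. *)

theory Defs
  imports "HOL-Analysis.Analysis"
begin

text \<open>
  An n-by-p real matrix has type \<open>real^'p^'n\<close>. The library norm and inner product on this type
  are the Frobenius norm and the trace inner product.
\<close>

definition gradient :: "('a::real_inner \<Rightarrow> real) \<Rightarrow> 'a \<Rightarrow> 'a" where
  "gradient F x = (THE g. GDERIV F x :> g)"

definition spectral_norm :: "real^'n^'q \<Rightarrow> real" where
  "spectral_norm B = onorm (\<lambda>x. B *v x)"

definition stiefel :: "(real^'p^'n) set" where
  "stiefel = {X. transpose X ** X = mat 1}"

text \<open>
  The formula for the orthogonal projection onto the tangent space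
  \<open>{Y. transpose Y ** X + transpose X ** Y = 0}\<close> of the Stiefel manifold at \<open>X\<close>.
\<close>

definition proj_tangent :: "real^'p^'n \<Rightarrow> real^'p^'n \<Rightarrow> real^'p^'n" where
  "proj_tangent X Y = (mat 1 - X ** transpose X) ** Y
     + (1/2) *\<^sub>R (X ** (transpose X ** Y - transpose Y ** X))"

text \<open>
  Clarke's generalized directional derivative, the limes superior of
  \<open>(F (Y + t D) - F Y) / t\<close> as \<open>Y\<close> tends to \<open>X\<close> (with \<open>Y = X\<close> allowed) and \<open>t\<close> tends to 0
  from above.
\<close>

definition clarke_dir_deriv :: "('a::real_inner \<Rightarrow> real) \<Rightarrow> 'a \<Rightarrow> 'a \<Rightarrow> ereal" where
  "clarke_dir_deriv F X D =
     Limsup (nhds X \<times>\<^sub>F at_right 0) (\<lambda>(Y, t). ereal ((F (Y + t *\<^sub>R D) - F Y) / t))"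

definition clarke_subdifferential :: "('a::real_inner \<Rightarrow> real) \<Rightarrow> 'a \<Rightarrow> 'a set" where
  "clarke_subdifferential F X = {G. \<forall>D. ereal (G \<bullet> D) \<le> clarke_dir_deriv F X D}"

definition first_order_stationary :: "(real^'p^'n \<Rightarrow> real) \<Rightarrow> real^'p^'n \<Rightarrow> bool" where
  "first_order_stationary F X \<longleftrightarrow>
     X \<in> stiefel \<and> 0 \<in> proj_tangent X ` clarke_subdifferential F X"

definition objective ::
  "(real^'p^'q \<Rightarrow> real) \<Rightarrow> (real^'p^'n \<Rightarrow> real) \<Rightarrow> real^'n^'q \<Rightarrow> real^'p^'n \<Rightarrow> real" where
  "objective f h B X = f (B ** X) + h X"

text \<open>
  Moreau envelope. For a convex Lipschitz \<open>f\<close> and \<open>\<mu> > 0\<close> the infimum is a minimum.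
\<close>

definition moreau_env :: "('a::real_inner \<Rightarrow> real) \<Rightarrow> 'a \<Rightarrow> real \<Rightarrow> real" where
  "moreau_env f Z \<mu> = (INF Y. f Y + 1 / (2 * \<mu>) * (norm (Y - Z))\<^sup>2)"

definition smoothed_objective ::
  "(real^'p^'q \<Rightarrow> real) \<Rightarrow> (real^'p^'n \<Rightarrow> real) \<Rightarrow> real^'n^'q \<Rightarrow> real^'p^'n \<Rightarrow> real \<Rightarrow> real" where
  "smoothed_objective f h B X \<mu> = moreau_env f (B ** X) \<mu> + h X"

definition positive_semidefinite :: "real^'p^'p \<Rightarrow> bool" where
  "positive_semidefinite A \<longleftrightarrow> transpose A = A \<and> (\<forall>x. 0 \<le> x \<bullet> (A *v x))"

definition psd_sqrt :: "real^'p^'p \<Rightarrow> real^'p^'p" where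
  "psd_sqrt A = (THE R. positive_semidefinite R \<and> R ** R = A)"

definition retr :: "real^'p^'n \<Rightarrow> real^'p^'n \<Rightarrow> real^'p^'n" where
  "retr X \<xi> = (X + \<xi>) ** matrix_inv (psd_sqrt (mat 1 + transpose \<xi> ** \<xi>))"

definition sufficient_decrease ::
  "(real^'p^'n \<Rightarrow> real) \<Rightarrow> real^'p^'n \<Rightarrow> real^'p^'n \<Rightarrow> real \<Rightarrow> bool" where
  "sufficient_decrease G X V t \<longleftrightarrow>
     G (retr X (- (t *\<^sub>R V))) \<le> G X - t / 2 * (norm V)\<^sup>2"

text \<open>
  \<open>L\<close> is the Lipschitz constant of \<open>f\<close> and \<open>L'\<close> that of the gradient of \<open>h\<close>. The exponent \<open>j\<close>
  is the number of times the trial step size is multiplied by \<open>\<eta>\<close>: the accepted step size is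
  the first one passing the test. The parameter preceding \<open>\<mu> 0\<close> equals \<open>\<mu> 0\<close>, which is what
  \<open>\<mu> (k - 1)\<close> yields at \<open>k = 0\<close> with truncated subtraction.
\<close>

definition srgd_sequence ::
  "(real^'p^'q \<Rightarrow> real) \<Rightarrow> (real^'p^'n \<Rightarrow> real) \<Rightarrow> real^'n^'q \<Rightarrow> real \<Rightarrow> real \<Rightarrow>
   real \<Rightarrow> real \<Rightarrow> real \<Rightarrow>
   (nat \<Rightarrow> real^'p^'n) \<Rightarrow> (nat \<Rightarrow> real^'p^'n) \<Rightarrow> (nat \<Rightarrow> real) \<Rightarrow> (nat \<Rightarrow> real) \<Rightarrow> bool" where
  "srgd_sequence f h B L L' \<sigma> \<alpha> \<eta> X V \<tau> \<mu> \<longleftrightarrow>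
     X 0 \<in> stiefel \<and> \<mu> 0 > 0 \<and>
     (\<forall>k.
       (let F = smoothed_objective f h B; G = (\<lambda>Y. F Y (\<mu> k));
            \<kappa> = L\<^sup>2 / 2; t = inverse ((spectral_norm B)\<^sup>2 / \<mu> k + L')
        in V k = proj_tangent (X k) (gradient G (X k)) \<and>
           (\<exists>j. sufficient_decrease G (X k) (V k) (\<eta> ^ j * t) \<and>
                (\<forall>i<j. \<not> sufficient_decrease G (X k) (V k) (\<eta> ^ i * t)) \<and>
                \<tau> k = \<eta> ^ j * t) \<and>
           X (Suc k) = retr (X k) (- (\<tau> k *\<^sub>R V k)) \<and>
           \<mu> (Suc k) =
             (if F (X (Suc k)) (\<mu> k) + \<kappa> * \<mu> k - F (X k) (\<mu> (k - 1)) - \<kappa> * \<mu> (k - 1)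
                   \<le> - \<alpha> * (\<mu> k)\<^sup>2
              then \<mu> k else \<mu> 0 / real (k + 1) powr \<sigma>)))"

definition accumulation_point_along :: "(nat \<Rightarrow> 'a::topological_space) \<Rightarrow> nat set \<Rightarrow> 'a \<Rightarrow> bool" where
  "accumulation_point_along X A x \<longleftrightarrow>
     (\<exists>r. strict_mono r \<and> range r \<subseteq> A \<and> (X \<circ> r) \<longlonglongrightarrow> x)"

end

theory Submission
  imports Defs
begin

text \<open>
  At every iteration after which the smoothing parameter changes, the progress test has failed:
  the merit value
  \<open>F\<^sub>k = smoothed_objective f h B (X k) (\<mu> (k - 1)) + \<kappa> * \<mu> (k - 1)\<close>
  has decreased by less than \<open>\<alpha> * (\<mu> k)\<^sup>2\<close>. Lowering the smoothing parameter never raises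
  \<open>moreau_env f z \<mu> + \<kappa> * \<mu>\<close> for \<open>\<kappa> = L\<^sup>2 / 2\<close> (\<open>moreau_env_antimono_param\<close>), so the decrease of the
  line search is a lower bound for the decrease of \<open>F\<^sub>k\<close>, and hence
  \<open>\<tau> k / 2 * (norm (V k))\<^sup>2 \<le> \<alpha> * (\<mu> k)\<^sup>2\<close> at such iterations.

  The step size \<open>\<tau> k\<close> is at least a constant times \<open>\<mu> k\<close>. Indeed the gradient of the smoothed
  objective is bounded by some \<open>C\<close> on the Stiefel manifold and the smoothed objective has a quadratic upper model
  with curvature \<open>M = (spectral_norm B)\<^sup>2 / \<mu> + L'\<close>, while the polar retraction is a first-order
  retraction, with \<open>norm (retr X \<xi> - X) \<le> 2 * norm \<xi>\<close> and
  \<open>norm (retr X \<xi> - X - \<xi>) \<le> (norm \<xi>)\<^sup>2 / 2\<close> (\<open>retr_bounds\<close>). Every step of size at most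
  \<open>1 / (C + 4 * M)\<close> therefore passes the sufficient decrease test, and backtracking stops no later
  than a factor \<open>\<eta>\<close> below that (\<open>backtracking_step_lower_bound\<close>). Altogether
  \<open>(norm (V k))\<^sup>2\<close> is at most of order \<open>\<mu> k\<close> at the iterations in question. An accumulation point along
  them presupposes that there are infinitely many, so \<open>\<mu>\<close> decreases to zero,
  and \<open>V\<close> tends to zero along them.

  It remains to pass to the limit. \<open>V k\<close> is the tangential projection of
  \<open>transpose B ** u + gradient h (X k)\<close>, where \<open>u\<close> is a subgradient of \<open>f\<close> at the proximal point
  \<open>B ** X k - \<mu> k *\<^sub>R u\<close>. These subgradients are bounded by the Lipschitz constant of \<open>f\<close>, so they
  have a convergent subsequence; the proximal points converge to \<open>B ** Xbar\<close>, and the limit is a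
  subgradient of \<open>f\<close> there. The sum with \<open>gradient h Xbar\<close> is a Clarke subgradient of the objective
  whose projection vanishes (\<open>first_order_stationary_limit\<close>).
\<close>

section \<open>Matrices with the Frobenius inner product\<close>

lemma column_matrix_mult: "column j (A ** B) = A *v column j B"
  for A :: "real^'n^'q"
  by (simp add: column_def matrix_matrix_mult_def matrix_vector_mult_def vec_eq_iff)

lemma inner_matrix_columns: "A \<bullet> C = (\<Sum>j\<in>UNIV. column j A \<bullet> column j C)"
  for A C :: "real^'p^'n"
  by (simp add: inner_vec_def column_def) (rule sum.swap)

lemma inner_transpose: "transpose A \<bullet> transpose C = A \<bullet> C"
  for A C :: "real^'p^'n"
  by (simp add: inner_vec_def transpose_def) (rule sum.swap)

lemma norm_transpose: "norm (transpose A) = norm A"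
  for A :: "real^'p^'n"
  by (simp add: norm_eq_sqrt_inner inner_transpose)

lemma inner_matrix_mult_left: "(A ** B) \<bullet> C = B \<bullet> (transpose A ** C)"
  for A :: "real^'n^'q"
proof -
  have "(A *v b) \<bullet> c = b \<bullet> (transpose A *v c)" for b c
    by (metis dot_lmul_matrix inner_commute transpose_matrix_vector)
  then show ?thesis
    by (simp only: inner_matrix_columns column_matrix_mult)
qed

text \<open>
  A bound on the action on vectors bounds the action on matrices in the Frobenius norm, because
  the columns of the second factor are transformed independently.
\<close>

lemma norm_matrix_mult_le:
  fixes A :: "real^'n^'q" and B :: "real^'p^'n"
  assumes "\<And>x. norm (A *v x) \<le> r * norm x" and "0 \<le> r"
  shows "norm (A ** B) \<le> r * norm B"
proof -
  have "(norm (A ** B))\<^sup>2 = (\<Sum>j\<in>UNIV. (norm (A *v column j B))\<^sup>2)"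
    by (simp add: power2_norm_eq_inner inner_matrix_columns column_matrix_mult)
  also have "\<dots> \<le> (\<Sum>j\<in>UNIV. (r * norm (column j B))\<^sup>2)"
    by (intro sum_mono power_mono assms) simp
  also have "\<dots> = (r * norm B)\<^sup>2"
    by (simp add: power_mult_distrib sum_distrib_left[symmetric] power2_norm_eq_inner
        inner_matrix_columns)
  finally show ?thesis by (rule power2_le_imp_le) (simp add: assms(2))
qed

lemma norm_matrix_vector_mult_le: "norm (A *v x) \<le> norm A * norm x"
  for A :: "real^'n^'q"
proof -
  have "(norm (A *v x))\<^sup>2 = (\<Sum>i\<in>UNIV. (A $ i \<bullet> x)\<^sup>2)"
    unfolding power2_norm_eq_inner inner_vec_def[of "A *v x" "A *v x"]
    by (simp add: matrix_vector_mul_component power2_eq_square)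
  also have "\<dots> \<le> (\<Sum>i\<in>UNIV. (norm (A $ i) * norm x)\<^sup>2)"
    by (intro sum_mono) (metis Cauchy_Schwarz_ineq2 abs_le_square_iff abs_norm_cancel abs_mult)
  also have "\<dots> = (norm A * norm x)\<^sup>2"
    unfolding power_mult_distrib sum_distrib_right[symmetric] power2_norm_eq_inner
      inner_vec_def[of A A] ..
  finally show ?thesis by (rule power2_le_imp_le) simp
qed

interpretation matrix_mult: bounded_bilinear "(**) :: real^'n^'q \<Rightarrow> real^'p^'n \<Rightarrow> real^'p^'q"
proof
  fix a a' :: "real^'n^'q" and b b' :: "real^'p^'n" and r :: real
  show "(a + a') ** b = a ** b + a' ** b"
    by (simp add: matrix_matrix_mult_def vec_eq_iff distrib_right sum.distrib)
  show "a ** (b + b') = a ** b + a ** b'"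
    by (simp add: matrix_add_ldistrib)
  show "(r *\<^sub>R a) ** b = r *\<^sub>R (a ** b)"
    by (simp add: matrix_matrix_mult_def vec_eq_iff sum_distrib_left mult_ac)
  show "a ** (r *\<^sub>R b) = r *\<^sub>R (a ** b)"
    by (simp add: matrix_matrix_mult_def vec_eq_iff sum_distrib_left mult_ac)
  show "\<exists>K. \<forall>a b. norm (a ** b :: real^'p^'q) \<le> norm (a :: real^'n^'q) * norm (b :: real^'p^'n) * K"
    by (rule exI[of _ 1]) (simp add: norm_matrix_mult_le norm_matrix_vector_mult_le)
qed

lemma bounded_linear_transpose: "bounded_linear (transpose :: real^'p^'n \<Rightarrow> real^'n^'p)"
  by (rule bounded_linear_intro[of _ 1])
    (simp_all add: transpose_def vec_eq_iff norm_transpose[unfolded transpose_def])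

lemmas transpose_add = linear_add[OF bounded_linear.linear[OF bounded_linear_transpose]]
lemmas transpose_diff = linear_diff[OF bounded_linear.linear[OF bounded_linear_transpose]]
lemmas tendsto_transpose = bounded_linear.tendsto[OF bounded_linear_transpose]

lemma spectral_norm_mult_le: "norm (B ** Y) \<le> spectral_norm B * norm Y"
  for B :: "real^'n^'q"
  unfolding spectral_norm_def
  by (intro norm_matrix_mult_le onorm onorm_pos_le) simp_all

lemma spectral_norm_nonneg: "0 \<le> spectral_norm B"
  for B :: "real^'n^'q"
  unfolding spectral_norm_def by (rule onorm_pos_le) simp

lemma spectral_norm_pos: "0 < spectral_norm B" if "B \<noteq> 0"
  for B :: "real^'n^'q"
proof (rule ccontr)
  assume "\<not> 0 < spectral_norm B"
  then have "norm (B ** mat 1) \<le> 0"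
    using spectral_norm_mult_le[of B "mat 1"] spectral_norm_nonneg[of B] by simp
  with that show False by simp
qed

text \<open>
  A matrix and its transpose have the same spectral norm; the bound follows by moving the transpose
  across the inner product.
\<close>

lemma spectral_norm_transpose_mult_le: "norm (transpose B ** Y) \<le> spectral_norm B * norm Y"
  for B :: "real^'n^'q"
proof -
  let ?Z = "transpose B ** Y"
  have "norm ?Z * norm ?Z = (B ** ?Z) \<bullet> Y"
    by (metis inner_commute inner_matrix_mult_left power2_norm_eq_inner power2_eq_square)
  also have "\<dots> \<le> norm (B ** ?Z) * norm Y" by (rule norm_cauchy_schwarz)
  also have "\<dots> \<le> (spectral_norm B * norm ?Z) * norm Y"
    by (intro mult_right_mono spectral_norm_mult_le) simp
  finally show ?thesis
    using spectral_norm_nonneg[of B]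
    by (cases "norm ?Z = 0") (simp_all add: mult.commute mult.left_commute)
qed

section \<open>Square roots of positive definite matrices\<close>

text \<open>
  The Frobenius inner product adds up the values of the quadratic form on the columns of \<open>D\<close>.
  With \<open>D = mat 1\<close> this is nonnegativity of the trace of \<open>P\<close>, with \<open>D = P\<close> of the trace of its cube.
\<close>

lemma psd_inner_mult_nonneg: "0 \<le> D \<bullet> (P ** D)" if "positive_semidefinite P"
  for P :: "real^'p^'p" and D :: "real^'m^'p"
  using that unfolding inner_matrix_columns column_matrix_mult positive_semidefinite_def
  by (simp add: sum_nonneg)

lemma psd_cauchy_schwarz:
  assumes "positive_semidefinite P"
  shows "(x \<bullet> (P *v y))\<^sup>2 \<le> (x \<bullet> (P *v x)) * (y \<bullet> (P *v y))"
proof -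
  let ?a = "y \<bullet> (P *v y)" and ?b = "x \<bullet> (P *v y)" and ?c = "x \<bullet> (P *v x)"
  have sym: "y \<bullet> (P *v x) = ?b"
    using assms unfolding positive_semidefinite_def
    by (metis dot_lmul_matrix inner_commute transpose_matrix_vector)
  have q: "0 \<le> ?c + 2 * s * ?b + s\<^sup>2 * ?a" for s
  proof -
    have "0 \<le> (x + s *\<^sub>R y) \<bullet> (P *v (x + s *\<^sub>R y))"
      using assms by (simp add: positive_semidefinite_def)
    also have "\<dots> = ?c + 2 * s * ?b + s\<^sup>2 * ?a"
      by (simp add: matrix_vector_right_distrib matrix_vector_mult_scaleR inner_add_left
          inner_add_right sym power2_eq_square algebra_simps)
    finally show ?thesis .
  qed
  have a: "0 \<le> ?a" using assms by (simp add: positive_semidefinite_def)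
  show ?thesis
  proof (cases "?a = 0")
    case True
    have "?b = 0"
    proof (rule ccontr)
      assume "?b \<noteq> 0"
      with q[of "- (?c + 1) / (2 * ?b)"] True show False by (simp add: field_simps)
    qed
    then show ?thesis using True by simp
  next
    case False
    have "0 \<le> ?c - ?b\<^sup>2 / ?a"
      using q[of "- ?b / ?a"] False by (simp add: power2_eq_square field_simps)
    then show ?thesis using False a by (simp add: field_simps)
  qed
qed

text \<open>
  For a symmetric matrix the operator norm is governed by the quadratic form: apply the
  Cauchy-Schwarz inequality of the form to \<open>T *v x\<close> and \<open>x\<close>.
\<close>

lemma psd_contraction:
  assumes "positive_semidefinite T" and le: "\<And>x. x \<bullet> (T *v x) \<le> r * (x \<bullet> x)" and "0 \<le> r"
  shows "norm (T *v x) \<le> r * norm x"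
proof -
  let ?y = "T *v x"
  have "(norm ?y)\<^sup>2 * (norm ?y)\<^sup>2 = (?y \<bullet> (T *v x))\<^sup>2"
    by (simp only: power2_norm_eq_inner power2_eq_square[of "_ \<bullet> _"])
  also have "\<dots> \<le> (?y \<bullet> (T *v ?y)) * (x \<bullet> (T *v x))"
    by (rule psd_cauchy_schwarz[OF assms(1)])
  also have "\<dots> \<le> (r * (?y \<bullet> ?y)) * (r * (x \<bullet> x))"
    using assms by (intro mult_mono le) (auto simp: positive_semidefinite_def)
  also have "\<dots> = (r * norm x)\<^sup>2 * (norm ?y)\<^sup>2"
    by (simp add: power2_norm_eq_inner[symmetric] power_mult_distrib) (simp add: power2_eq_square)
  finally have le2: "(norm ?y)\<^sup>2 * (norm ?y)\<^sup>2 \<le> (r * norm x)\<^sup>2 * (norm ?y)\<^sup>2" .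
  show ?thesis
  proof (cases "?y = 0")
    case False
    then have "(norm ?y)\<^sup>2 \<le> (r * norm x)\<^sup>2"
      using mult_right_le_imp_le[OF le2] by simp
    then show ?thesis by (rule power2_le_imp_le) (simp add: \<open>0 \<le> r\<close>)
  qed (simp add: \<open>0 \<le> r\<close>)
qed

text \<open>
  The difference \<open>D\<close> of two roots satisfies \<open>R ** D = - (D ** S)\<close>. Pairing with \<open>D\<close> gives two
  nonnegative quantities with sum zero, so both \<open>R\<close> and \<open>S\<close> annihilate \<open>D\<close>, and then so does
  \<open>D = R - S\<close> itself; but \<open>D\<close> is symmetric.
\<close>

lemma psd_sqrt_unique:
  assumes R: "positive_semidefinite R" and S: "positive_semidefinite S" and eq: "R ** R = S ** S"
  shows "R = S"
proof -
  define D where "D = R - S"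
  have sym: "transpose R = R" "transpose S = S" "transpose D = D"
    using R S by (auto simp: positive_semidefinite_def D_def transpose_diff)
  have "R ** D + D ** S = 0"
    by (simp add: D_def matrix_mult.diff_left matrix_mult.diff_right eq)
  then have "D \<bullet> (R ** D) + D \<bullet> (D ** S) = 0"
    by (metis inner_add_right inner_zero_right)
  moreover have "D \<bullet> (D ** S) = D \<bullet> (S ** D)"
    by (metis inner_transpose matrix_transpose_mul sym(2,3))
  ultimately have 0: "D \<bullet> (R ** D) = 0" "D \<bullet> (S ** D) = 0"
    using psd_inner_mult_nonneg[OF R, of D] psd_inner_mult_nonneg[OF S, of D] by linarith+
  have ker: "P ** D = 0" if P: "positive_semidefinite P" and z: "D \<bullet> (P ** D) = 0" for P
  proof -
    have "column j D \<bullet> (P *v column j D) = 0" for j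
      using z P unfolding inner_matrix_columns column_matrix_mult
      by (subst (asm) sum_nonneg_eq_0_iff) (auto simp: positive_semidefinite_def)
    then have "(x \<bullet> (P *v column j D))\<^sup>2 \<le> 0" for x j
      using psd_cauchy_schwarz[OF P, of x "column j D"] by simp
    then have "column j (P ** D) = 0" for j
      by (metis column_matrix_mult inner_eq_zero_iff power2_less_eq_zero_iff)
    then show ?thesis
      by (simp add: column_def vec_eq_iff)
  qed
  have "D ** D = R ** D - S ** D"
    by (simp add: D_def matrix_mult.diff_left)
  then have "D ** D = 0"
    using ker[OF R 0(1)] ker[OF S 0(2)] by simp
  then have "D \<bullet> D = 0"
    by (metis inner_matrix_mult_left inner_zero_right matrix_mul_rid sym(3))
  then show ?thesis by (simp add: D_def)
qed

text \<open>
  Writing the root as \<open>mat 1 - Y\<close> turns the equation into the fixed-point problem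
  \<open>Y = (T + Y ** Y) / 2\<close>. On symmetric matrices of operator norm at most
  \<open>r = 1 - sqrt (1 - \<rho>) < 1\<close> the right-hand side is a self-map and a contraction for the Frobenius
  distance, so Banach's theorem provides a solution.
\<close>

lemma psd_sqrt_exists_near_identity:
  fixes T :: "real^'p^'p"
  assumes T: "positive_semidefinite T" and le: "\<And>x. x \<bullet> (T *v x) \<le> \<rho> * (x \<bullet> x)"
    and \<rho>: "0 \<le> \<rho>" "\<rho> < 1"
  shows "\<exists>R. positive_semidefinite R \<and> R ** R = mat 1 - T"
proof -
  define r where "r = 1 - sqrt (1 - \<rho>)"
  have r: "0 \<le> r" "r < 1" using \<rho> by (auto simp: r_def)
  (* The choice of r is the smaller root of this equation, so the ball of radius r is invariant. *)
  have rr: "(\<rho> + r * r) / 2 = r"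
    using \<rho> real_sqrt_pow2[of "1 - \<rho>"]
    by (simp add: r_def field_simps power2_eq_square)
  define s where "s = {Y :: real^'p^'p. transpose Y = Y \<and> (\<forall>x. norm (Y *v x) \<le> r * norm x)}"
  define g where "g Y = (1/2) *\<^sub>R (T + Y ** Y)" for Y :: "real^'p^'p"
  have cont: "continuous_on UNIV (\<lambda>Y. Y *v x)" for x :: "real^'p"
    unfolding matrix_vector_mult_def by (intro continuous_intros)
  have "closed s"
    unfolding s_def
    by (intro closed_Collect_conj closed_Collect_eq closed_Collect_all closed_Collect_le
        continuous_intros cont linear_continuous_on bounded_linear_transpose)
  then have "complete s" by (simp add: complete_eq_closed)
  moreover have "0 \<in> s"
    using r by (simp add: s_def linear_0[OF bounded_linear.linear[OF bounded_linear_transpose]])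
  moreover have "g ` s \<subseteq> s"
  proof
    fix Z assume "Z \<in> g ` s"
    then obtain Y where Y: "Y \<in> s" "Z = g Y" by auto
    have "transpose Z = Z"
      using Y T by (simp add: g_def s_def positive_semidefinite_def transpose_scalar
          transpose_add matrix_transpose_mul)
    moreover have "norm (Z *v x) \<le> r * norm x" for x
    proof -
      have "norm (Y *v (Y *v x)) \<le> r * norm (Y *v x)" using Y by (simp add: s_def)
      also have "\<dots> \<le> r * (r * norm x)" using Y r by (intro mult_left_mono) (auto simp: s_def)
      finally have "norm (T *v x + Y *v (Y *v x)) \<le> \<rho> * norm x + r * (r * norm x)"
        using psd_contraction[OF T le \<rho>(1), of x] norm_triangle_ineq[of "T *v x" "Y *v (Y *v x)"]
        by linarith
      moreover have "Z *v x = (1/2) *\<^sub>R (T *v x + Y *v (Y *v x))"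
        by (simp add: Y g_def scaleR_matrix_vector_assoc[symmetric] matrix_vector_mult_add_rdistrib
            matrix_vector_mul_assoc)
      then have "norm (Z *v x) = norm (T *v x + Y *v (Y *v x)) / 2"
        by (simp only: norm_scaleR)
      ultimately have "norm (Z *v x) \<le> (\<rho> + r * r) / 2 * norm x"
        by (simp add: field_simps)
      then show ?thesis by (simp add: rr)
    qed
    ultimately show "Z \<in> s" by (simp add: s_def)
  qed
  moreover have "dist (g Y) (g Z) \<le> r * dist Y Z" if "Y \<in> s \<and> Z \<in> s" for Y Z
  proof -
    have "norm (Y ** (Y - Z)) \<le> r * norm (Y - Z)"
      using that r by (intro norm_matrix_mult_le) (auto simp: s_def)
    moreover have "(Y - Z) ** Z = transpose (Z ** (Y - Z))"
      using that by (simp add: matrix_transpose_mul transpose_diff s_def)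
    then have "norm ((Y - Z) ** Z) = norm (Z ** (Y - Z))"
      by (simp only: norm_transpose)
    moreover have "norm (Z ** (Y - Z)) \<le> r * norm (Y - Z)"
      using that r by (intro norm_matrix_mult_le) (auto simp: s_def)
    ultimately have "norm (Y ** (Y - Z) + (Y - Z) ** Z) \<le> 2 * (r * norm (Y - Z))"
      using norm_triangle_ineq[of "Y ** (Y - Z)" "(Y - Z) ** Z"] by linarith
    moreover have "g Y - g Z = (1/2) *\<^sub>R (Y ** (Y - Z) + (Y - Z) ** Z)"
      by (simp add: g_def matrix_mult.diff_left matrix_mult.diff_right algebra_simps)
    ultimately show ?thesis by (simp add: dist_norm)
  qed
  ultimately obtain Y where Y: "Y \<in> s" "g Y = Y"
    using Banach_fix[of s r g] r by auto
  have "T + Y ** Y = 2 *\<^sub>R g Y" by (simp add: g_def)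
  then have YY: "Y ** Y = 2 *\<^sub>R Y - T" by (simp add: Y(2) algebra_simps)
  show ?thesis
  proof (intro exI[of _ "mat 1 - Y"] conjI)
    have "0 \<le> x \<bullet> ((mat 1 - Y) *v x)" for x
    proof -
      have "x \<bullet> (Y *v x) \<le> norm x * norm (Y *v x)" by (rule norm_cauchy_schwarz)
      also have "\<dots> \<le> norm x * (r * norm x)"
        using Y by (intro mult_left_mono) (auto simp: s_def)
      also have "\<dots> \<le> norm x * (1 * norm x)"
        using r by (intro mult_left_mono mult_right_mono) auto
      finally show ?thesis
        by (simp add: matrix_vector_mult_diff_rdistrib inner_diff_right power2_norm_eq_inner[symmetric]
            power2_eq_square)
    qed
    then show "positive_semidefinite (mat 1 - Y)"
      using Y by (simp add: positive_semidefinite_def transpose_diff s_def)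
    show "(mat 1 - Y) ** (mat 1 - Y) = mat 1 - T"
      by (simp add: matrix_mult.diff_left matrix_mult.diff_right YY scaleR_2)
  qed
qed

text \<open>
  A positive definite matrix becomes \<open>mat 1 - T\<close>, with \<open>T\<close> positive semidefinite of norm less than
  one, after division by a large constant.
\<close>

lemma psd_sqrt_exists:
  fixes A :: "real^'p^'p"
  assumes sym: "transpose A = A" and pos: "\<And>x. \<epsilon> * (x \<bullet> x) \<le> x \<bullet> (A *v x)" and "0 < \<epsilon>"
  shows "\<exists>R. positive_semidefinite R \<and> R ** R = A"
proof -
  define c where "c = \<epsilon> + norm A"
  define T where "T = mat 1 - (1/c) *\<^sub>R A"
  have c: "0 < c" "\<epsilon> \<le> c" using \<open>0 < \<epsilon>\<close> by (auto simp: c_def add_pos_nonneg)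
  have T_form: "x \<bullet> (T *v x) = x \<bullet> x - (x \<bullet> (A *v x)) / c" for x
    by (simp add: T_def matrix_vector_mult_diff_rdistrib scaleR_matrix_vector_assoc[symmetric]
        inner_diff_right)
  have A_le: "x \<bullet> (A *v x) \<le> c * (x \<bullet> x)" for x
  proof -
    have "x \<bullet> (A *v x) \<le> norm x * norm (A *v x)" by (rule norm_cauchy_schwarz)
    also have "\<dots> \<le> norm x * (norm A * norm x)"
      by (intro mult_left_mono norm_matrix_vector_mult_le) simp
    also have "\<dots> \<le> norm x * (c * norm x)"
      using \<open>0 < \<epsilon>\<close> by (intro mult_left_mono mult_right_mono) (auto simp: c_def)
    finally show ?thesis
      by (simp add: power2_norm_eq_inner[symmetric] power2_eq_square algebra_simps)
  qed
  have "positive_semidefinite T"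
    using A_le c(1) sym
    by (simp add: positive_semidefinite_def T_form T_def transpose_diff transpose_scalar field_simps)
      (simp add: T_form[unfolded T_def] field_simps)
  moreover have "x \<bullet> (T *v x) \<le> (1 - \<epsilon> / c) * (x \<bullet> x)" for x
    using pos[of x] c(1) by (simp add: T_form field_simps)
  ultimately obtain R where R: "positive_semidefinite R" "R ** R = mat 1 - T"
    using psd_sqrt_exists_near_identity[of T "1 - \<epsilon> / c"] c \<open>0 < \<epsilon>\<close> by auto
  show ?thesis
  proof (intro exI[of _ "sqrt c *\<^sub>R R"] conjI)
    show "positive_semidefinite (sqrt c *\<^sub>R R)"
      using R c by (simp add: positive_semidefinite_def transpose_scalar
          scaleR_matrix_vector_assoc[symmetric])
    have "(sqrt c *\<^sub>R R) ** (sqrt c *\<^sub>R R) = c *\<^sub>R (R ** R)"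
      using c by (simp add: matrix_mult.scaleR_left matrix_mult.scaleR_right)
    then show "(sqrt c *\<^sub>R R) ** (sqrt c *\<^sub>R R) = A"
      using c by (simp add: R T_def)
  qed
qed

lemma psd_sqrt_works:
  fixes A :: "real^'p^'p"
  assumes "transpose A = A" and "\<And>x. \<epsilon> * (x \<bullet> x) \<le> x \<bullet> (A *v x)" and "0 < \<epsilon>"
  shows "positive_semidefinite (psd_sqrt A)" "psd_sqrt A ** psd_sqrt A = A"
proof -
  have "\<exists>!R. positive_semidefinite R \<and> R ** R = A"
    using psd_sqrt_exists[OF assms] psd_sqrt_unique by metis
  from theI'[OF this]
  show "positive_semidefinite (psd_sqrt A)" "psd_sqrt A ** psd_sqrt A = A"
    by (simp_all add: psd_sqrt_def)
qed

section \<open>The polar retraction\<close>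

lemma invertible_psd_sqrt:
  fixes S :: "real^'p^'p"
  assumes "positive_semidefinite S" and "\<And>x. x \<bullet> x \<le> x \<bullet> ((S ** S) *v x)"
  shows "S ** matrix_inv S = mat 1" "matrix_inv S ** S = mat 1"
proof -
  have "x = 0" if "S *v x = 0" for x
    using assms(2)[of x] that
    by (simp add: matrix_vector_mul_assoc[symmetric] power2_norm_eq_inner[symmetric])
  then have "invertible S"
    using matrix_left_invertible_ker[of S] invertible_left_inverse[of S] by blast
  then show "S ** matrix_inv S = mat 1" "matrix_inv S ** S = mat 1"
    unfolding invertible_def matrix_inv_def by (metis (mono_tags, lifting) someI_ex)+
qed

text \<open>
  Operator monotonicity of the square root, in the case of a comparison with the identity. For
  \<open>x = S *v y\<close> the hypothesis says \<open>norm y \<le> norm x\<close>, and the Cauchy-Schwarz inequality of the form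
  of \<open>S\<close> applied to \<open>x\<close> and \<open>y\<close> yields \<open>x \<bullet> x \<le> x \<bullet> (S *v x)\<close>.
\<close>

lemma psd_sqrt_ge_identity:
  fixes S :: "real^'p^'p"
  assumes S: "positive_semidefinite S" and ge: "\<And>x. x \<bullet> x \<le> x \<bullet> ((S ** S) *v x)"
  shows "positive_semidefinite (S - mat 1)"
proof -
  have sym: "transpose S = S" using S by (simp add: positive_semidefinite_def)
  have "x \<bullet> x \<le> x \<bullet> (S *v x)" for x
  proof (cases "x = 0")
    case False
    define y where "y = matrix_inv S *v x"
    have Sy: "S *v y = x"
      by (simp add: y_def matrix_vector_mul_assoc invertible_psd_sqrt(1)[OF assms])
    have "y \<bullet> ((S ** S) *v y) = x \<bullet> x"
      by (metis Sy dot_lmul_matrix matrix_vector_mul_assoc sym transpose_matrix_vector)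
    then have "y \<bullet> y \<le> x \<bullet> x" using ge[of y] by simp
    then have "norm y \<le> norm x" by (simp add: norm_eq_sqrt_inner)
    have "y \<bullet> (S *v y) \<le> norm y * norm x"
      by (simp add: Sy norm_cauchy_schwarz)
    also have "\<dots> \<le> norm x * norm x" using \<open>norm y \<le> norm x\<close> by (intro mult_right_mono) auto
    finally have le: "y \<bullet> (S *v y) \<le> x \<bullet> x"
      by (simp add: power2_norm_eq_inner[symmetric] power2_eq_square)
    have "(x \<bullet> x)\<^sup>2 \<le> (x \<bullet> (S *v x)) * (y \<bullet> (S *v y))"
      using psd_cauchy_schwarz[OF S, of x y] by (simp add: Sy)
    also have "\<dots> \<le> (x \<bullet> (S *v x)) * (x \<bullet> x)"
      using S le by (intro mult_left_mono) (auto simp: positive_semidefinite_def)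
    finally have "(x \<bullet> x) * (x \<bullet> x) \<le> (x \<bullet> (S *v x)) * (x \<bullet> x)"
      by (simp only: power2_eq_square)
    then show ?thesis
      by (rule mult_right_le_imp_le) (simp add: False)
  qed simp
  then show ?thesis
    by (simp add: positive_semidefinite_def transpose_diff sym matrix_vector_mult_diff_rdistrib
        inner_diff_right)
qed

lemma norm_stiefel_mult: "norm (R ** P) = norm P" if "R \<in> stiefel"
  for R :: "real^'p^'n" and P :: "real^'m^'p"
  using that by (simp add: norm_eq_sqrt_inner inner_matrix_mult_left matrix_mul_assoc stiefel_def)

text \<open>
  For a tangent vector the matrix \<open>X + \<xi>\<close> has Gram matrix \<open>mat 1 + transpose \<xi> ** \<xi>\<close>, whose root \<open>S\<close>
  is the positive factor of its polar decomposition. Hence \<open>retr X \<xi>\<close> is the isometric factor \<open>R\<close>,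
  and its deviation from \<open>X + \<xi>\<close> is \<open>R ** P\<close> with \<open>P = S - mat 1\<close>, which has the same norm as
  \<open>P\<close>. Both estimates come from \<open>P ** P + 2 *\<^sub>R P = transpose \<xi> ** \<xi>\<close>: taking norms bounds
  \<open>2 * norm P\<close> by \<open>(norm \<xi>)\<^sup>2\<close>, taking traces bounds \<open>(norm P)\<^sup>2\<close> by \<open>(norm \<xi>)\<^sup>2\<close>.
\<close>

lemma retr_bounds:
  fixes X \<xi> :: "real^'p^'n"
  assumes X: "X \<in> stiefel" and tangent: "transpose \<xi> ** X + transpose X ** \<xi> = 0"
  shows retr_in_stiefel: "retr X \<xi> \<in> stiefel"
    and norm_retr_diff_tangent_le: "norm (retr X \<xi> - X - \<xi>) \<le> (norm \<xi>)\<^sup>2 / 2"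
    and norm_retr_diff_le: "norm (retr X \<xi> - X) \<le> 2 * norm \<xi>"
proof -
  define N where "N = transpose \<xi> ** \<xi>"
  define S where "S = psd_sqrt (mat 1 + N)"
  define R where "R = retr X \<xi>"
  define P where "P = S - mat 1"
  have R: "R = (X + \<xi>) ** matrix_inv S" by (simp add: R_def retr_def S_def N_def)
  have symN: "transpose (mat 1 + N) = mat 1 + N"
    by (simp add: transpose_add N_def matrix_transpose_mul)
  have form: "x \<bullet> ((mat 1 + N) *v x) = x \<bullet> x + (\<xi> *v x) \<bullet> (\<xi> *v x)" for x
    by (metis N_def dot_lmul_matrix inner_add_right inner_commute matrix_vector_mul_assoc
        matrix_vector_mul_lid matrix_vector_mult_add_rdistrib transpose_matrix_vector)
  have S: "positive_semidefinite S" "S ** S = mat 1 + N"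
    unfolding S_def by (rule psd_sqrt_works[of _ 1]; simp add: symN form)+
  have ge: "x \<bullet> x \<le> x \<bullet> ((S ** S) *v x)" for x by (simp add: S form)
  note inv = invertible_psd_sqrt[OF S(1) ge]
  have symS: "transpose S = S" using S by (simp add: positive_semidefinite_def)
  have inv_t: "transpose (matrix_inv S) ** S = mat 1"
    by (metis inv(1) matrix_transpose_mul symS transpose_mat)
  have gram: "transpose (X + \<xi>) ** (X + \<xi>) = S ** S"
  proof -
    have "transpose (X + \<xi>) ** (X + \<xi>)
        = transpose X ** X + (transpose \<xi> ** X + transpose X ** \<xi>) + N"
      by (simp add: transpose_add matrix_mult.add_left matrix_mult.add_right N_def)
    then show ?thesis using X tangent S by (simp add: stiefel_def)
  qed
  have "transpose R ** R
      = transpose (matrix_inv S) ** (transpose (X + \<xi>) ** (X + \<xi>)) ** matrix_inv S"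
    by (simp add: R matrix_transpose_mul matrix_mul_assoc)
  also have "\<dots> = (transpose (matrix_inv S) ** S) ** (S ** matrix_inv S)"
    by (simp only: gram matrix_mul_assoc)
  finally have R_stiefel: "R \<in> stiefel" by (simp add: inv inv_t stiefel_def)
  then show "retr X \<xi> \<in> stiefel" by (simp add: R_def)
  have P: "positive_semidefinite P"
    unfolding P_def by (rule psd_sqrt_ge_identity[OF S(1) ge])
  then have symP: "transpose P = P" by (simp add: positive_semidefinite_def)
  have N: "N = P ** P + 2 *\<^sub>R P"
    using S(2) by (simp add: P_def matrix_mult.diff_left matrix_mult.diff_right scaleR_2)
  have "(2 * norm P)\<^sup>2 \<le> (norm N)\<^sup>2"
  proof -
    have "N \<bullet> N = (P ** P) \<bullet> (P ** P) + 4 * (P \<bullet> (P ** P)) + 4 * (P \<bullet> P)"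
      by (simp add: N inner_add_left inner_add_right inner_commute)
    then show ?thesis
      using psd_inner_mult_nonneg[OF P, of P]
      by (simp add: power_mult_distrib power2_norm_eq_inner)
  qed
  then have "2 * norm P \<le> norm N" by (rule power2_le_imp_le) simp
  also have "norm N \<le> norm (transpose \<xi>) * norm \<xi>"
    unfolding N_def by (intro norm_matrix_mult_le norm_matrix_vector_mult_le) simp
  finally have P2: "norm P \<le> (norm \<xi>)\<^sup>2 / 2"
    by (simp add: norm_transpose power2_eq_square)
  have P1: "norm P \<le> norm \<xi>"
  proof -
    have tr: "mat 1 \<bullet> (transpose D ** D) = D \<bullet> D" for D :: "real^'p^'m"
      using inner_matrix_mult_left[of D "mat 1" D] by simp
    have "\<xi> \<bullet> \<xi> = mat 1 \<bullet> N" by (simp add: N_def tr)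
    also have "\<dots> = P \<bullet> P + 2 * (mat 1 \<bullet> (P ** mat 1))"
      using tr[of P] by (simp add: N inner_add_right symP)
    also have "\<dots> \<ge> P \<bullet> P"
      using psd_inner_mult_nonneg[OF P, of "mat 1"] by linarith
    finally show ?thesis by (simp add: norm_eq_sqrt_inner)
  qed
  have RS: "R ** S = X + \<xi>"
    by (simp add: R matrix_mul_assoc[symmetric] inv)
  have diff: "R - X - \<xi> = - (R ** P)"
    by (simp add: P_def matrix_mult.diff_right RS)
  have nd: "norm (R - X - \<xi>) = norm P"
    by (simp add: diff norm_stiefel_mult[OF R_stiefel])
  then show "norm (retr X \<xi> - X - \<xi>) \<le> (norm \<xi>)\<^sup>2 / 2" using P2 by (simp add: R_def)
  have "norm (R - X) \<le> norm (R - X - \<xi>) + norm \<xi>"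
    using norm_triangle_ineq[of "R - X - \<xi>" \<xi>] by simp
  then show "norm (retr X \<xi> - X) \<le> 2 * norm \<xi>" using nd P1 by (simp add: R_def)
qed

section \<open>Projection onto the tangent space\<close>

lemma transpose_mult_proj_tangent:
  fixes X Y :: "real^'p^'n"
  assumes "X \<in> stiefel"
  shows "transpose X ** proj_tangent X Y = (1/2) *\<^sub>R (transpose X ** Y - transpose Y ** X)"
proof -
  have "transpose X ** (X ** Z) = Z" for Z :: "real^'p^'p"
    using assms by (simp add: matrix_mul_assoc stiefel_def)
  then show ?thesis
    unfolding proj_tangent_def
    by (simp add: matrix_mult.add_right matrix_mult.diff_left matrix_mult.diff_right
        matrix_mult.scaleR_right matrix_mul_assoc[symmetric])
qed

lemma proj_tangent_tangent:
  fixes X Y :: "real^'p^'n"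
  assumes "X \<in> stiefel"
  shows "transpose (proj_tangent X Y) ** X + transpose X ** proj_tangent X Y = 0"
proof -
  have "transpose (proj_tangent X Y) ** X = transpose (transpose X ** proj_tangent X Y)"
    by (simp add: matrix_transpose_mul)
  then show ?thesis
    by (simp add: transpose_mult_proj_tangent[OF assms] transpose_scalar transpose_diff
        matrix_transpose_mul scaleR_add_right[symmetric])
qed

lemma scaled_proj_tangent_tangent:
  fixes X Y :: "real^'p^'n"
  assumes "X \<in> stiefel"
  shows "transpose (- (t *\<^sub>R proj_tangent X Y)) ** X
    + transpose X ** (- (t *\<^sub>R proj_tangent X Y)) = 0"
proof -
  have "transpose (- (t *\<^sub>R proj_tangent X Y)) = - t *\<^sub>R transpose (proj_tangent X Y)"
    using transpose_scalar[of "- t" "proj_tangent X Y"] by simp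
  moreover have "- t *\<^sub>R (transpose (proj_tangent X Y) ** X + transpose X ** proj_tangent X Y) = 0"
    using proj_tangent_tangent[OF assms, of Y] by simp
  ultimately show ?thesis
    by (simp add: matrix_mult.minus_left matrix_mult.minus_right matrix_mult.scaleR_left
        matrix_mult.scaleR_right scaleR_add_right)
qed

text \<open>
  The remainder \<open>Y - proj_tangent X Y\<close> is \<open>X\<close> times a symmetric matrix, whereas a tangent vector
  multiplied by \<open>transpose X\<close> is skew-symmetric; so the two are orthogonal.
\<close>

lemma inner_proj_tangent:
  fixes X Y :: "real^'p^'n"
  assumes "X \<in> stiefel"
  shows "Y \<bullet> proj_tangent X Y = (norm (proj_tangent X Y))\<^sup>2"
proof -
  define W where "W = transpose X ** Y"
  have Wt: "transpose Y ** X = transpose W" by (simp add: W_def matrix_transpose_mul)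
  have half: "y - (y - a + (1/2) *\<^sub>R (a - b)) = (1/2) *\<^sub>R (a + b)" for y a b :: "real^'p^'n"
    by (simp add: vec_eq_iff field_simps)
  have "Y - proj_tangent X Y = X ** ((1/2) *\<^sub>R (W + transpose W))"
    unfolding proj_tangent_def Wt W_def[symmetric]
    by (simp add: W_def[symmetric] half matrix_mult.add_right matrix_mult.diff_left
        matrix_mult.diff_right matrix_mult.scaleR_right matrix_mul_assoc[symmetric])
  then have "(Y - proj_tangent X Y) \<bullet> proj_tangent X Y
      = ((1/2) *\<^sub>R (W + transpose W)) \<bullet> ((1/2) *\<^sub>R (W - transpose W))"
    by (simp add: inner_matrix_mult_left transpose_mult_proj_tangent[OF assms] Wt W_def[symmetric])
  also have "\<dots> = 0"
    using inner_transpose[of W W]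
    by (simp add: inner_add_left inner_add_right inner_diff_left inner_diff_right inner_commute)
  finally show ?thesis by (simp add: inner_diff_left power2_norm_eq_inner)
qed

lemma tendsto_proj_tangent:
  assumes "(X \<longlongrightarrow> X0) F" and "(Y \<longlongrightarrow> Y0) F"
  shows "((\<lambda>i. proj_tangent (X i) (Y i)) \<longlongrightarrow> proj_tangent X0 Y0) F"
  unfolding proj_tangent_def
  by (intro tendsto_intros matrix_mult.tendsto tendsto_transpose assms)

lemma closed_stiefel: "closed (stiefel :: (real^'p^'n) set)"
  unfolding stiefel_def
  by (intro closed_Collect_eq continuous_intros matrix_mult.continuous_on
      linear_continuous_on bounded_linear_transpose)

lemma norm_stiefel: "norm X = norm (mat 1 :: real^'p^'p)" if "X \<in> stiefel"
  for X :: "real^'p^'n"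
  using norm_stiefel_mult[OF that, of "mat 1"] by simp

section \<open>Backtracking along the retraction\<close>

text \<open>
  Along the retraction the quadratic model loses \<open>t * (norm V)\<^sup>2\<close> from its linear part. The
  second-order error of the retraction costs at most \<open>C * t\<^sup>2 / 2 * (norm V)\<^sup>2\<close>, and the curvature
  at most \<open>2 * M * t\<^sup>2 * (norm V)\<^sup>2\<close>. For small \<open>t\<close> half of the gain survives.
\<close>

lemma sufficient_decrease_if_small_step:
  fixes X g :: "real^'p^'n"
  assumes X: "X \<in> stiefel" and C: "norm g \<le> C"
    and descent: "\<And>Y. G Y \<le> G X + g \<bullet> (Y - X) + M / 2 * (norm (Y - X))\<^sup>2"
    and M: "0 \<le> M" and t: "0 < t" "t * (C + 4 * M) \<le> 1"
  shows "sufficient_decrease G X (proj_tangent X g) t"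
proof -
  define V where "V = proj_tangent X g"
  define \<xi> where "\<xi> = - (t *\<^sub>R V)"
  define E where "E = retr X \<xi> - X - \<xi>"
  have tangent: "transpose \<xi> ** X + transpose X ** \<xi> = 0"
    unfolding \<xi>_def V_def by (rule scaled_proj_tangent_tangent[OF X])
  have n\<xi>: "norm \<xi> = t * norm V" using t by (simp add: \<xi>_def)
  have C0: "0 \<le> C" using C norm_ge_zero order_trans by blast
  have "g \<bullet> E \<le> norm g * norm E" by (rule norm_cauchy_schwarz)
  also have "\<dots> \<le> C * ((norm \<xi>)\<^sup>2 / 2)"
    using C C0 norm_retr_diff_tangent_le[OF X tangent] by (intro mult_mono) (auto simp: E_def)
  finally have gE: "g \<bullet> E \<le> C * ((norm \<xi>)\<^sup>2 / 2)" .
  have "(norm (retr X \<xi> - X))\<^sup>2 \<le> (2 * norm \<xi>)\<^sup>2"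
    by (intro power_mono norm_retr_diff_le[OF X tangent]) simp
  then have quad: "M / 2 * (norm (retr X \<xi> - X))\<^sup>2 \<le> M / 2 * (4 * (norm \<xi>)\<^sup>2)"
    using M by (intro mult_left_mono) (auto simp: power_mult_distrib)
  have "retr X \<xi> - X = \<xi> + E" by (simp add: E_def)
  then have lin: "g \<bullet> (retr X \<xi> - X) = - t * (norm V)\<^sup>2 + g \<bullet> E"
    using inner_proj_tangent[OF X, of g] by (simp add: inner_diff_right \<xi>_def V_def)
  have "G (retr X \<xi>) \<le> G X - t * (norm V)\<^sup>2 + C * ((norm \<xi>)\<^sup>2 / 2) + M / 2 * (4 * (norm \<xi>)\<^sup>2)"
    using descent[of "retr X \<xi>"] gE quad lin by linarith
  also have "\<dots> = G X - t * (norm V)\<^sup>2 + (t * (C + 4 * M)) * (t / 2 * (norm V)\<^sup>2)"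
    by (simp add: n\<xi> power_mult_distrib) (simp add: field_simps power2_eq_square)
  also have "\<dots> \<le> G X - t * (norm V)\<^sup>2 + 1 * (t / 2 * (norm V)\<^sup>2)"
    using t by (intro add_left_mono mult_right_mono) auto
  finally show ?thesis by (simp add: sufficient_decrease_def \<xi>_def V_def)
qed

text \<open>
  Either the initial step \<open>inverse M\<close> is accepted, or the last rejected step exceeds
  \<open>1 / (C + 4 * M)\<close> and the accepted one is \<open>\<eta>\<close> times as large.
\<close>

lemma backtracking_step_lower_bound:
  fixes X g :: "real^'p^'n"
  assumes X: "X \<in> stiefel" and C: "norm g \<le> C"
    and descent: "\<And>Y. G Y \<le> G X + g \<bullet> (Y - X) + M / 2 * (norm (Y - X))\<^sup>2"
    and M: "0 < M" and \<eta>: "0 < \<eta>" "\<eta> < 1"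
    and first: "\<And>i. i < j \<Longrightarrow> \<not> sufficient_decrease G X (proj_tangent X g) (\<eta> ^ i * inverse M)"
  shows "\<eta> / (C + 4 * M) \<le> \<eta> ^ j * inverse M"
proof -
  have C0: "0 \<le> C" using C norm_ge_zero order_trans by blast
  show ?thesis
  proof (cases j)
    case 0
    have "\<eta> * M \<le> 1 * M" using \<eta> M by (intro mult_right_mono) auto
    then have "\<eta> * M \<le> C + 4 * M" using C0 M by linarith
    then show ?thesis using 0 M C0 by (simp add: field_simps)
  next
    case (Suc i)
    have "\<not> (\<eta> ^ i * inverse M) * (C + 4 * M) \<le> 1"
      using first[of i] sufficient_decrease_if_small_step[OF X C descent, of "\<eta> ^ i * inverse M"]
        Suc M \<eta> by auto
    then have "\<eta> * 1 \<le> \<eta> * ((\<eta> ^ i * inverse M) * (C + 4 * M))"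
      using \<eta> by (intro mult_left_mono) auto
    then show ?thesis
      using Suc M C0 by (simp add: pos_divide_le_eq add_nonneg_pos mult.assoc)
  qed
qed

section \<open>Subgradients and the Moreau envelope\<close>

definition convex_subdifferential :: "('a::real_inner \<Rightarrow> real) \<Rightarrow> 'a \<Rightarrow> 'a set" where
  "convex_subdifferential f z = {u. \<forall>y. f z + u \<bullet> (y - z) \<le> f y}"

lemma convex_subdifferential_norm_le:
  assumes "u \<in> convex_subdifferential f z" and "L-lipschitz_on UNIV f"
  shows "norm u \<le> L"
proof -
  have "u \<bullet> u \<le> f (z + u) - f z"
    using assms(1) by (auto simp: convex_subdifferential_def dest!: spec[of _ "z + u"])
  also have "\<dots> \<le> dist (f (z + u)) (f z)" by (simp add: dist_real_def)
  also have "\<dots> \<le> L * dist (z + u) z" using assms(2) by (auto simp: lipschitz_on_def)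
  finally have "norm u * norm u \<le> L * norm u"
    by (simp add: dist_norm power2_norm_eq_inner[symmetric] power2_eq_square)
  then show ?thesis
    using lipschitz_on_nonneg[OF assms(2)] by (cases "norm u = 0") auto
qed

text \<open>
  If \<open>u\<close> is a subgradient at \<open>z - \<mu> *\<^sub>R u\<close>, this point is the minimizer in the definition of
  \<open>moreau_env f z \<mu>\<close>. Replacing \<open>f\<close> by its affine minorant and completing the square gives a lower
  bound at every \<open>z'\<close>, whose infimum over \<open>y\<close> shows at once the value of the envelope
  (for \<open>z' = z\<close>) and that \<open>u\<close> is a subgradient of the envelope.
\<close>

lemma moreau_objective_lower_bound:
  assumes u: "u \<in> convex_subdifferential f (z - \<mu> *\<^sub>R u)" and "0 < \<mu>"
  shows "f (z - \<mu> *\<^sub>R u) + \<mu> / 2 * (norm u)\<^sup>2 + u \<bullet> (z' - z)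
    \<le> f y + 1 / (2 * \<mu>) * (norm (y - z'))\<^sup>2"
proof -
  have "0 \<le> (norm (y - z' + \<mu> *\<^sub>R u))\<^sup>2" by simp
  also have "\<dots> = (norm (y - z'))\<^sup>2 + 2 * \<mu> * (u \<bullet> (y - z')) + \<mu>\<^sup>2 * (norm u)\<^sup>2"
    unfolding power2_norm_eq_inner
    by (simp add: inner_add_left inner_add_right inner_commute power2_eq_square algebra_simps)
  finally have "0 \<le> 1 / (2 * \<mu>) * ((norm (y - z'))\<^sup>2 + 2 * \<mu> * (u \<bullet> (y - z')) + \<mu>\<^sup>2 * (norm u)\<^sup>2)"
    using \<open>0 < \<mu>\<close> by simp
  also have "\<dots> = 1 / (2 * \<mu>) * (norm (y - z'))\<^sup>2 + u \<bullet> (y - z') + \<mu> / 2 * (norm u)\<^sup>2"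
    using \<open>0 < \<mu>\<close> by (simp add: field_simps power2_eq_square)
  finally have 1: "0 \<le> 1 / (2 * \<mu>) * (norm (y - z'))\<^sup>2 + u \<bullet> (y - z') + \<mu> / 2 * (norm u)\<^sup>2" .
  have "f (z - \<mu> *\<^sub>R u) + u \<bullet> (y - (z - \<mu> *\<^sub>R u)) \<le> f y"
    using u by (simp add: convex_subdifferential_def)
  moreover have "u \<bullet> (y - (z - \<mu> *\<^sub>R u)) = u \<bullet> (y - z') + u \<bullet> (z' - z) + \<mu> * (norm u)\<^sup>2"
    unfolding power2_norm_eq_inner by (simp add: inner_diff_right inner_add_right)
  moreover have "\<mu> * (norm u)\<^sup>2 = \<mu> / 2 * (norm u)\<^sup>2 + \<mu> / 2 * (norm u)\<^sup>2" by simp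
  ultimately show ?thesis using 1 by linarith
qed

lemma moreau_env_eq:
  assumes u: "u \<in> convex_subdifferential f (z - \<mu> *\<^sub>R u)" and "0 < \<mu>"
  shows "moreau_env f z \<mu> = f (z - \<mu> *\<^sub>R u) + \<mu> / 2 * (norm u)\<^sup>2"
  unfolding moreau_env_def
proof (rule cInf_eq_minimum)
  have "1 / (2 * \<mu>) * (norm (z - \<mu> *\<^sub>R u - z))\<^sup>2 = \<mu> / 2 * (norm u)\<^sup>2"
    using \<open>0 < \<mu>\<close> by (simp add: power2_eq_square)
  then show "f (z - \<mu> *\<^sub>R u) + \<mu> / 2 * (norm u)\<^sup>2
      \<in> range (\<lambda>Y. f Y + 1 / (2 * \<mu>) * (norm (Y - z))\<^sup>2)"
    by (intro range_eqI[of _ _ "z - \<mu> *\<^sub>R u"]) simp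
  show "f (z - \<mu> *\<^sub>R u) + \<mu> / 2 * (norm u)\<^sup>2 \<le> x"
    if "x \<in> range (\<lambda>Y. f Y + 1 / (2 * \<mu>) * (norm (Y - z))\<^sup>2)" for x
    using that moreau_objective_lower_bound[OF assms, of z] by auto
qed

text \<open>
  The proximal objective grows quadratically while \<open>f\<close> falls at most linearly, so it attains its
  minimum in a ball of radius \<open>2 * \<mu> * L\<close>. Convexity turns minimality at \<open>p\<close> into the subgradient
  inequality for \<open>u = (z - p) / \<mu>\<close>, by comparing \<open>p\<close> with points \<open>p + t *\<^sub>R (y - p)\<close> and letting
  \<open>t\<close> tend to zero.
\<close>

lemma proximal_point_exists:
  fixes f :: "'a::euclidean_space \<Rightarrow> real"
  assumes "convex_on UNIV f" and lip: "L-lipschitz_on UNIV f" and \<mu>: "0 < \<mu>"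
  shows "\<exists>u. u \<in> convex_subdifferential f (z - \<mu> *\<^sub>R u)"
proof -
  define \<phi> where "\<phi> y = f y + 1 / (2 * \<mu>) * (norm (y - z))\<^sup>2" for y
  have L: "0 \<le> L" by (rule lipschitz_on_nonneg[OF lip])
  have "continuous_on (cball z (2 * \<mu> * L)) \<phi>"
    unfolding \<phi>_def
    by (intro continuous_intros continuous_on_subset[OF lipschitz_on_continuous_on[OF lip]]) auto
  then obtain p where p: "p \<in> cball z (2 * \<mu> * L)" "\<And>y. y \<in> cball z (2 * \<mu> * L) \<Longrightarrow> \<phi> p \<le> \<phi> y"
    using continuous_attains_inf[of "cball z (2 * \<mu> * L)" \<phi>] L \<mu> by (auto simp: not_less)
  have min: "\<phi> p \<le> \<phi> y" for y
  proof (cases "y \<in> cball z (2 * \<mu> * L)")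
    case False
    then have "2 * \<mu> * L \<le> norm (y - z)" by (simp add: dist_norm norm_minus_commute)
    then have "L * norm (y - z) \<le> 1 / (2 * \<mu>) * (norm (y - z) * norm (y - z))"
      using \<mu> mult_right_mono[of "2 * \<mu> * L" "norm (y - z)" "norm (y - z)"]
      by (simp add: field_simps)
    moreover have "f z - f y \<le> L * norm (y - z)"
      using lipschitz_onD[OF lip, of z y] by (simp add: dist_norm norm_minus_commute)
    ultimately have "\<phi> z \<le> \<phi> y" by (simp add: \<phi>_def power2_eq_square)
    moreover have "\<phi> p \<le> \<phi> z" using p(2)[of z] L \<mu> by simp
    ultimately show ?thesis by simp
  qed (rule p(2))
  define u where "u = (1 / \<mu>) *\<^sub>R (z - p)"
  have pu: "z - \<mu> *\<^sub>R u = p" using \<mu> by (simp add: u_def)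
  have "f p + u \<bullet> (y - p) \<le> f y" for y
  proof -
    have "u \<bullet> (y - p) - t * ((norm (y - p))\<^sup>2 / (2 * \<mu>)) \<le> f y - f p" if t: "0 < t" "t < 1" for t
    proof -
      let ?y = "p + t *\<^sub>R (y - p)"
      have "f ?y \<le> (1 - t) * f p + t * f y"
        using convex_onD[OF assms(1), of t p y] t by (simp add: algebra_simps)
      moreover have "\<phi> p \<le> \<phi> ?y" by (rule min)
      moreover have "(norm (?y - z))\<^sup>2
          = (norm (p - z))\<^sup>2 - 2 * t * \<mu> * (u \<bullet> (y - p)) + t\<^sup>2 * (norm (y - p))\<^sup>2"
      proof -
        have "p - z = - (\<mu> *\<^sub>R u)" "?y - z = t *\<^sub>R (y - p) - \<mu> *\<^sub>R u"
          using \<mu> by (simp_all add: u_def)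
        moreover have "(norm (t *\<^sub>R d - \<mu> *\<^sub>R u))\<^sup>2
            = (norm (- (\<mu> *\<^sub>R u)))\<^sup>2 - 2 * t * \<mu> * (u \<bullet> d) + t\<^sup>2 * (norm d)\<^sup>2" for d
          unfolding power2_norm_eq_inner
          by (simp add: inner_diff_left inner_diff_right inner_commute power2_eq_square algebra_simps)
        ultimately show ?thesis by metis
      qed
      then have "1 / (2 * \<mu>) * (norm (?y - z))\<^sup>2 = 1 / (2 * \<mu>) * (norm (p - z))\<^sup>2
          - t * (u \<bullet> (y - p)) + t * (t * ((norm (y - p))\<^sup>2 / (2 * \<mu>)))"
        using \<mu> by (simp add: field_simps power2_eq_square)
      ultimately have "t * (u \<bullet> (y - p) - t * ((norm (y - p))\<^sup>2 / (2 * \<mu>))) \<le> t * (f y - f p)"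
        by (simp add: \<phi>_def algebra_simps)
      then show ?thesis using t by simp
    qed
    then have "\<forall>\<^sub>F t in at_right 0. u \<bullet> (y - p) - t * ((norm (y - p))\<^sup>2 / (2 * \<mu>)) \<le> f y - f p"
      by (auto simp: eventually_at_right_field intro!: exI[of _ 1])
    moreover have "((\<lambda>t. u \<bullet> (y - p) - t * ((norm (y - p))\<^sup>2 / (2 * \<mu>)))
        \<longlongrightarrow> u \<bullet> (y - p) - 0 * ((norm (y - p))\<^sup>2 / (2 * \<mu>))) (at_right 0)"
      by (intro tendsto_intros)
    ultimately have "u \<bullet> (y - p) - 0 * ((norm (y - p))\<^sup>2 / (2 * \<mu>)) \<le> f y - f p"
      by (intro tendsto_upperbound) auto
    then show ?thesis by simp
  qed
  then have "u \<in> convex_subdifferential f (z - \<mu> *\<^sub>R u)"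
    by (simp add: convex_subdifferential_def pu)
  then show ?thesis ..
qed

lemma moreau_env_lower:
  assumes u: "u \<in> convex_subdifferential f (z - \<mu> *\<^sub>R u)" and \<mu>: "0 < \<mu>"
  shows "moreau_env f z \<mu> + u \<bullet> (z' - z) \<le> moreau_env f z' \<mu>"
  unfolding moreau_env_def[of f z'] moreau_env_eq[OF u \<mu>]
  by (rule cINF_greatest) (use moreau_objective_lower_bound[OF u \<mu>, of z'] in auto)

text \<open>
  The proximal point of \<open>z\<close> is a competitor in the minimum that defines the envelope at \<open>z'\<close>.
\<close>

lemma moreau_env_upper:
  fixes f :: "'a::euclidean_space \<Rightarrow> real"
  assumes f: "convex_on UNIV f" "L-lipschitz_on UNIV f"
    and u: "u \<in> convex_subdifferential f (z - \<mu> *\<^sub>R u)" and \<mu>: "0 < \<mu>"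
  shows "moreau_env f z' \<mu> \<le> moreau_env f z \<mu> + u \<bullet> (z' - z) + 1 / (2 * \<mu>) * (norm (z' - z))\<^sup>2"
proof -
  obtain v where v: "v \<in> convex_subdifferential f (z' - \<mu> *\<^sub>R v)"
    using proximal_point_exists[OF f \<mu>] by blast
  have "moreau_env f z' \<mu>
      \<le> f (z - \<mu> *\<^sub>R u) + 1 / (2 * \<mu>) * (norm (z - \<mu> *\<^sub>R u - z'))\<^sup>2"
    using moreau_objective_lower_bound[OF v \<mu>, of z'] by (simp add: moreau_env_eq[OF v \<mu>])
  moreover have "(norm (z - \<mu> *\<^sub>R u - z'))\<^sup>2
      = \<mu>\<^sup>2 * (norm u)\<^sup>2 + 2 * \<mu> * (u \<bullet> (z' - z)) + (norm (z' - z))\<^sup>2"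
    unfolding power2_norm_eq_inner
    by (simp add: inner_diff_left inner_diff_right inner_commute power2_eq_square algebra_simps)
  then have "1 / (2 * \<mu>) * (norm (z - \<mu> *\<^sub>R u - z'))\<^sup>2
      = \<mu> / 2 * (norm u)\<^sup>2 + u \<bullet> (z' - z) + 1 / (2 * \<mu>) * (norm (z' - z))\<^sup>2"
    using \<mu> by (simp add: field_simps power2_eq_square)
  ultimately show ?thesis by (simp add: moreau_env_eq[OF u \<mu>])
qed

text \<open>
  The envelope has derivative \<open>- (norm u)\<^sup>2 / 2\<close> in the smoothing parameter, where \<open>norm u \<le> L\<close>, so
  the term \<open>L\<^sup>2 / 2 * \<mu>\<close> compensates its growth as \<open>\<mu>\<close> falls. The integrated
  form of this is the subgradient inequality between the proximal points for \<open>\<mu>\<close> and \<open>\<mu>'\<close>.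
\<close>

lemma moreau_env_antimono_param:
  fixes f :: "'a::euclidean_space \<Rightarrow> real"
  assumes f: "convex_on UNIV f" "L-lipschitz_on UNIV f" and \<mu>: "0 < \<mu>'" "\<mu>' \<le> \<mu>"
  shows "moreau_env f z \<mu>' + L\<^sup>2 / 2 * \<mu>' \<le> moreau_env f z \<mu> + L\<^sup>2 / 2 * \<mu>"
proof -
  obtain u where u: "u \<in> convex_subdifferential f (z - \<mu> *\<^sub>R u)"
    using proximal_point_exists[OF f, of \<mu>] \<mu> by auto
  obtain v where v: "v \<in> convex_subdifferential f (z - \<mu>' *\<^sub>R v)"
    using proximal_point_exists[OF f \<mu>(1)] by blast
  have "f (z - \<mu>' *\<^sub>R v) + v \<bullet> (z - \<mu> *\<^sub>R u - (z - \<mu>' *\<^sub>R v)) \<le> f (z - \<mu> *\<^sub>R u)"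
    using v unfolding convex_subdifferential_def by blast
  moreover have "v \<bullet> (z - \<mu> *\<^sub>R u - (z - \<mu>' *\<^sub>R v)) = \<mu>' * (norm v)\<^sup>2 - \<mu> * (v \<bullet> u)"
    by (simp add: power2_norm_eq_inner inner_diff_right)
  moreover have "0 \<le> \<mu> / 2 * (norm (u - v))\<^sup>2" using \<mu> by simp
  moreover have "(norm (u - v))\<^sup>2 = (norm u)\<^sup>2 - 2 * (v \<bullet> u) + (norm v)\<^sup>2"
    by (simp add: power2_norm_eq_inner inner_diff_left inner_diff_right inner_commute)
  then have "\<mu> / 2 * (norm (u - v))\<^sup>2 = \<mu> / 2 * (norm u)\<^sup>2 - \<mu> * (v \<bullet> u) + \<mu> / 2 * (norm v)\<^sup>2"
    by (simp only:) (simp add: field_simps)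
  moreover have "\<mu>' * (norm v)\<^sup>2 + (\<mu> - \<mu>') / 2 * (norm v)\<^sup>2
      = \<mu> / 2 * (norm v)\<^sup>2 + \<mu>' / 2 * (norm v)\<^sup>2"
    by (simp add: field_simps)
  ultimately have "f (z - \<mu>' *\<^sub>R v) + \<mu>' / 2 * (norm v)\<^sup>2
      \<le> f (z - \<mu> *\<^sub>R u) + \<mu> / 2 * (norm u)\<^sup>2 + (\<mu> - \<mu>') / 2 * (norm v)\<^sup>2"
    by linarith
  moreover have "(\<mu> - \<mu>') / 2 * (norm v)\<^sup>2 \<le> (\<mu> - \<mu>') / 2 * L\<^sup>2"
    using convex_subdifferential_norm_le[OF v f(2)] \<mu> by (intro mult_left_mono power_mono) auto
  moreover have "(\<mu> - \<mu>') / 2 * L\<^sup>2 = L\<^sup>2 / 2 * \<mu> - L\<^sup>2 / 2 * \<mu>'"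
    by (simp add: field_simps)
  moreover have "0 < \<mu>" using \<mu> by simp
  ultimately show ?thesis
    unfolding moreau_env_eq[OF u \<open>0 < \<mu>\<close>] moreau_env_eq[OF v \<mu>(1)] by linarith
qed

section \<open>Gradients and the smoothed objective\<close>

lemma GDERIV_if_quadratic_remainder:
  fixes g :: "'a::real_inner \<Rightarrow> real"
  assumes "\<And>y. \<bar>g y - g x - d \<bullet> (y - x)\<bar> \<le> c * (norm (y - x))\<^sup>2"
  shows "GDERIV g x :> d"
proof -
  have "((\<lambda>y. (g y - g x - (y - x) \<bullet> d) /\<^sub>R norm (y - x)) \<longlongrightarrow> 0) (at x)"
  proof (rule Lim_null_comparison)
    show "\<forall>\<^sub>F y in at x. norm ((g y - g x - (y - x) \<bullet> d) /\<^sub>R norm (y - x)) \<le> c * norm (y - x)"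
    proof (intro always_eventually allI)
      fix y
      show "norm ((g y - g x - (y - x) \<bullet> d) /\<^sub>R norm (y - x)) \<le> c * norm (y - x)"
        using assms[of y]
        by (cases "y = x") (simp_all add: field_simps power2_eq_square inner_commute[of d])
    qed
    have "((\<lambda>y. c * norm (y - x)) \<longlongrightarrow> c * norm (x - x)) (at x)" by (intro tendsto_intros)
    then show "((\<lambda>y. c * norm (y - x)) \<longlongrightarrow> 0) (at x)" by simp
  qed
  then show ?thesis
    unfolding gderiv_def has_derivative_at_within
    by (simp add: bounded_linear_inner_left)
qed

lemma gradient_eqI: "gradient F x = g" if "GDERIV F x :> g"
proof -
  have "g' = g" if "GDERIV F x :> g'" for g'
    using has_derivative_unique[OF that[unfolded gderiv_def] \<open>GDERIV F x :> g\<close>[unfolded gderiv_def]]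
    by (metis inner_commute vector_eq_ldot)
  with that show ?thesis unfolding gradient_def by blast
qed

lemma GDERIV_gradient:
  fixes F :: "'a::euclidean_space \<Rightarrow> real"
  assumes "F differentiable (at x)"
  shows "GDERIV F x :> gradient F x"
proof -
  obtain D where D: "(F has_derivative D) (at x)" using assms unfolding differentiable_def by blast
  have "D = (\<lambda>d. d \<bullet> adjoint D 1)"
    using adjoint_works[OF has_derivative_linear[OF D], of _ 1] by simp
  then have "GDERIV F x :> adjoint D 1" using D by (simp add: gderiv_def)
  then show ?thesis using gradient_eqI by metis
qed

lemma has_real_derivative_along_line:
  assumes "GDERIV F (x + t *\<^sub>R d) :> g"
  shows "((\<lambda>s. F (x + s *\<^sub>R d)) has_real_derivative g \<bullet> d) (at t)"
proof -
  have "((\<lambda>s. x + s *\<^sub>R d) has_derivative (\<lambda>s. s *\<^sub>R d)) (at t)"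
    by (auto intro!: derivative_eq_intros)
  from has_derivative_compose[OF this assms[unfolded gderiv_def]]
  show ?thesis
    by (simp add: has_field_derivative_def inner_commute mult_commute_abs)
qed

text \<open>
  On the segment from \<open>x\<close> to \<open>y\<close> the slope of \<open>h\<close> grows at rate at most
  \<open>L * (norm (y - x))\<^sup>2\<close>, so subtracting the quadratic with this second derivative leaves a function
  that lies below its tangent at \<open>x\<close>.
\<close>

lemma lipschitz_gradient_upper_bound:
  fixes h :: "'a::euclidean_space \<Rightarrow> real"
  assumes diff: "\<And>y. h differentiable (at y)" and lip: "L-lipschitz_on UNIV (gradient h)"
  shows "h y \<le> h x + gradient h x \<bullet> (y - x) + L / 2 * (norm (y - x))\<^sup>2"
proof -
  define d where "d = y - x"
  define \<phi> where "\<phi> t = h (x + t *\<^sub>R d) - t * (gradient h x \<bullet> d) - L / 2 * (norm d)\<^sup>2 * t\<^sup>2" for t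
  have "\<phi> 0 \<ge> \<phi> 1"
  proof (rule DERIV_nonpos_imp_nonincreasing[where f = \<phi>])
    fix t :: real assume t: "0 \<le> t" "t \<le> 1"
    let ?g = "gradient h (x + t *\<^sub>R d)"
    let ?D = "?g \<bullet> d - gradient h x \<bullet> d - L * (norm d)\<^sup>2 * t"
    have "(\<phi> has_real_derivative ?D) (at t)"
      unfolding \<phi>_def
      by (auto intro!: derivative_eq_intros
          has_real_derivative_along_line[OF GDERIV_gradient[OF diff]])
    moreover have "?D \<le> 0"
    proof -
      have "(?g - gradient h x) \<bullet> d \<le> norm (?g - gradient h x) * norm d"
        by (rule norm_cauchy_schwarz)
      also have "\<dots> \<le> (L * norm (t *\<^sub>R d)) * norm d"
        using lipschitz_onD[OF lip, of "x + t *\<^sub>R d" x]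
        by (intro mult_right_mono) (auto simp: dist_norm)
      finally show ?thesis
        using t by (simp add: inner_diff_left power2_eq_square mult_ac)
    qed
    ultimately show "\<exists>D. (\<phi> has_real_derivative D) (at t) \<and> D \<le> 0" by blast
  qed simp
  then show ?thesis by (simp add: \<phi>_def d_def)
qed

text \<open>
  The envelope lies between its affine minorant and the same function plus a quadratic, hence is
  differentiable with gradient \<open>u\<close>; the rest is the chain rule.
\<close>

lemma GDERIV_smoothed_objective:
  fixes f :: "real^'p^'q \<Rightarrow> real" and h :: "real^'p^'n \<Rightarrow> real"
  assumes f: "convex_on UNIV f" "L-lipschitz_on UNIV f"
    and h: "h differentiable (at X)" and \<mu>: "0 < \<mu>"
    and u: "u \<in> convex_subdifferential f (B ** X - \<mu> *\<^sub>R u)"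
  shows "GDERIV (\<lambda>Y. smoothed_objective f h B Y \<mu>) X :> transpose B ** u + gradient h X"
proof -
  have up: "moreau_env f z \<mu> \<le> moreau_env f (B ** X) \<mu> + u \<bullet> (z - B ** X)
      + 1 / (2 * \<mu>) * (norm (z - B ** X))\<^sup>2" for z
    by (rule moreau_env_upper[OF f u \<mu>])
  have lo: "moreau_env f (B ** X) \<mu> + u \<bullet> (z - B ** X) \<le> moreau_env f z \<mu>" for z
    by (rule moreau_env_lower[OF u \<mu>])
  have "GDERIV (\<lambda>z. moreau_env f z \<mu>) (B ** X) :> u"
  proof (rule GDERIV_if_quadratic_remainder)
    show "\<bar>moreau_env f z \<mu> - moreau_env f (B ** X) \<mu> - u \<bullet> (z - B ** X)\<bar>
        \<le> 1 / (2 * \<mu>) * (norm (z - B ** X))\<^sup>2" for z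
      using up[of z] lo[of z] by linarith
  qed
  then have "((\<lambda>Y. moreau_env f (B ** Y) \<mu>) has_derivative (\<lambda>D. (B ** D) \<bullet> u)) (at X)"
    unfolding gderiv_def
    by (rule has_derivative_compose[rotated])
      (rule bounded_linear.has_derivative[OF matrix_mult.bounded_linear_right has_derivative_ident])
  then have "GDERIV (\<lambda>Y. moreau_env f (B ** Y) \<mu>) X :> transpose B ** u"
    by (simp add: gderiv_def inner_matrix_mult_left)
  then show ?thesis
    unfolding smoothed_objective_def by (rule GDERIV_add) (rule GDERIV_gradient[OF h])
qed

lemma smoothed_objective_upper_bound:
  fixes f :: "real^'p^'q \<Rightarrow> real" and h :: "real^'p^'n \<Rightarrow> real"
  assumes f: "convex_on UNIV f" "L-lipschitz_on UNIV f"
    and h: "\<And>Y. h differentiable (at Y)" "L'-lipschitz_on UNIV (gradient h)" and \<mu>: "0 < \<mu>"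
    and u: "u \<in> convex_subdifferential f (B ** X - \<mu> *\<^sub>R u)"
  shows "smoothed_objective f h B Y \<mu> \<le> smoothed_objective f h B X \<mu>
    + (transpose B ** u + gradient h X) \<bullet> (Y - X)
    + ((spectral_norm B)\<^sup>2 / \<mu> + L') / 2 * (norm (Y - X))\<^sup>2"
proof -
  have BY: "B ** Y - B ** X = B ** (Y - X)" by (simp add: matrix_mult.diff_right)
  have "(norm (B ** (Y - X)))\<^sup>2 \<le> (spectral_norm B * norm (Y - X))\<^sup>2"
    by (intro power_mono spectral_norm_mult_le) simp
  then have "1 / (2 * \<mu>) * (norm (B ** (Y - X)))\<^sup>2
      \<le> 1 / (2 * \<mu>) * ((spectral_norm B)\<^sup>2 * (norm (Y - X))\<^sup>2)"
    using \<mu> by (intro mult_left_mono) (simp_all add: power_mult_distrib)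
  also have "\<dots> = (spectral_norm B)\<^sup>2 / \<mu> / 2 * (norm (Y - X))\<^sup>2" by simp
  finally have "moreau_env f (B ** Y) \<mu> \<le> moreau_env f (B ** X) \<mu> + u \<bullet> (B ** (Y - X))
      + (spectral_norm B)\<^sup>2 / \<mu> / 2 * (norm (Y - X))\<^sup>2"
    using moreau_env_upper[OF f u \<mu>, of "B ** Y"] unfolding BY by linarith
  moreover have "u \<bullet> (B ** (Y - X)) = (transpose B ** u) \<bullet> (Y - X)"
    using inner_matrix_mult_left[of "transpose B" u "Y - X"] by simp
  moreover have "h Y \<le> h X + gradient h X \<bullet> (Y - X) + L' / 2 * (norm (Y - X))\<^sup>2"
    by (rule lipschitz_gradient_upper_bound[OF h])
  ultimately show ?thesis
    by (simp add: smoothed_objective_def inner_add_left add_divide_distrib distrib_right)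
qed

section \<open>Stationarity in the limit\<close>

text \<open>
  Difference quotients with base point \<open>X\<close> itself already dominate the claimed slope in the limit,
  and they form a subfamily of those in Clarke's directional derivative.
\<close>

lemma clarke_subdifferential_objective:
  fixes f :: "real^'p^'q \<Rightarrow> real" and h :: "real^'p^'n \<Rightarrow> real"
  assumes u: "u \<in> convex_subdifferential f (B ** X)" and h: "h differentiable (at X)"
  shows "transpose B ** u + gradient h X \<in> clarke_subdifferential (objective f h B) X"
proof -
  let ?G = "transpose B ** u + gradient h X" and ?F = "objective f h B"
  have "ereal (?G \<bullet> D) \<le> clarke_dir_deriv ?F X D" for D
  proof -
    let ?q = "\<lambda>(Y, t). ereal ((?F (Y + t *\<^sub>R D) - ?F Y) / t)"
    let ?lb = "\<lambda>t. u \<bullet> (B ** D) + (h (X + t *\<^sub>R D) - h X) / t"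
    have "((\<lambda>s. h (X + s *\<^sub>R D)) has_real_derivative gradient h X \<bullet> D) (at 0)"
      using has_real_derivative_along_line[of h X 0 D] GDERIV_gradient[OF h] by simp
    then have "((\<lambda>t. (h (X + t *\<^sub>R D) - h X) / t) \<longlongrightarrow> gradient h X \<bullet> D) (at 0)"
      by (simp add: DERIV_def)
    from tendsto_add[OF tendsto_const Lim_at_imp_Lim_at_within[OF this]]
    have "(?lb \<longlongrightarrow> u \<bullet> (B ** D) + gradient h X \<bullet> D) (at_right 0)" .
    moreover have "u \<bullet> (B ** D) + gradient h X \<bullet> D = ?G \<bullet> D"
      using inner_matrix_mult_left[of "transpose B" u D] by (simp add: inner_add_left)
    ultimately have "((\<lambda>t. ereal (?lb t)) \<longlongrightarrow> ereal (?G \<bullet> D)) (at_right 0)"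
      by simp
    then have "ereal (?G \<bullet> D) = Limsup (at_right 0) (\<lambda>t. ereal (?lb t))"
      by (intro lim_imp_Limsup[symmetric]) auto
    also have "\<dots> \<le> Limsup (at_right 0) (\<lambda>t. ?q (X, t))"
    proof (rule Limsup_mono)
      have "?lb t \<le> (?F (X + t *\<^sub>R D) - ?F X) / t" if "0 < t" for t
      proof -
        have "B ** (X + t *\<^sub>R D) - B ** X = t *\<^sub>R (B ** D)"
          by (simp add: matrix_mult.add_right matrix_mult.scaleR_right)
        moreover have "f (B ** X) + u \<bullet> (B ** (X + t *\<^sub>R D) - B ** X) \<le> f (B ** (X + t *\<^sub>R D))"
          using u unfolding convex_subdifferential_def by blast
        ultimately have "t * (u \<bullet> (B ** D)) \<le> f (B ** (X + t *\<^sub>R D)) - f (B ** X)" by simp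
        then have "u \<bullet> (B ** D) \<le> (f (B ** (X + t *\<^sub>R D)) - f (B ** X)) / t"
          using that by (simp add: pos_le_divide_eq mult.commute)
        then show ?thesis
          by (simp add: objective_def add_divide_distrib diff_divide_distrib)
      qed
      then show "\<forall>\<^sub>F t in at_right 0. ereal (?lb t) \<le> ?q (X, t)"
        by (auto simp: eventually_at_right_field intro!: exI[of _ 1])
    qed
    also have "\<dots> \<le> Limsup (filtermap (\<lambda>t. (X, t)) (at_right 0)) ?q"
      by (rule Limsup_filtermap_ge)
    also have "\<dots> \<le> Limsup (nhds X \<times>\<^sub>F at_right 0) ?q"
    proof -
      have "filtermap (\<lambda>t. (X, t)) (at_right 0) \<le> nhds X \<times>\<^sub>F at_right (0::real)"
        using filterlim_Pair[OF tendsto_const filterlim_ident]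
        by (simp add: filterlim_def)
      then show ?thesis
        unfolding Limsup_def by (intro INF_superset_mono) (auto simp: le_filter_def)
    qed
    finally show ?thesis by (simp add: clarke_dir_deriv_def)
  qed
  then show ?thesis by (simp add: clarke_subdifferential_def)
qed

text \<open>
  The subgradient inequality at the proximal points involves only \<open>f\<close> and inner products, both
  continuous, so it survives the limit along a subsequence on which the bounded subgradients converge;
  as \<open>\<mu>\<close> tends to zero the proximal points are drawn to \<open>B ** Xbar\<close>.
\<close>

lemma first_order_stationary_limit:
  fixes f :: "real^'p^'q \<Rightarrow> real" and h :: "real^'p^'n \<Rightarrow> real"
  assumes f: "L-lipschitz_on UNIV f"
    and h: "\<And>Y. h differentiable (at Y)" "L'-lipschitz_on UNIV (gradient h)"
    and X: "\<And>i. X i \<in> stiefel" "X \<longlonglongrightarrow> Xbar" and \<mu>: "\<mu> \<longlonglongrightarrow> 0"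
    and u: "\<And>i. u i \<in> convex_subdifferential f (B ** X i - \<mu> i *\<^sub>R u i)"
    and V: "(\<lambda>i. proj_tangent (X i) (transpose B ** u i + gradient h (X i))) \<longlonglongrightarrow> 0"
  shows "first_order_stationary (objective f h B) Xbar"
proof -
  have "bounded (range u)"
    using convex_subdifferential_norm_le[OF u f] by (auto simp: bounded_iff)
  then obtain ubar r where r: "strict_mono r" "(u \<circ> r) \<longlonglongrightarrow> ubar"
    using bounded_imp_convergent_subsequence by blast
  have Xr: "(\<lambda>i. X (r i)) \<longlonglongrightarrow> Xbar" and \<mu>r: "(\<lambda>i. \<mu> (r i)) \<longlonglongrightarrow> 0"
    using LIMSEQ_subseq_LIMSEQ[OF X(2) r(1)] LIMSEQ_subseq_LIMSEQ[OF \<mu> r(1)] by (simp_all add: o_def)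
  have ur: "(\<lambda>i. u (r i)) \<longlonglongrightarrow> ubar" using r(2) by (simp add: o_def)
  have "(\<lambda>i. B ** X (r i) - \<mu> (r i) *\<^sub>R u (r i)) \<longlonglongrightarrow> B ** Xbar - 0 *\<^sub>R ubar"
    by (intro tendsto_intros matrix_mult.tendsto Xr \<mu>r ur)
  then have p: "(\<lambda>i. B ** X (r i) - \<mu> (r i) *\<^sub>R u (r i)) \<longlonglongrightarrow> B ** Xbar" by simp
  have f_cont: "isCont f z" for z
    using lipschitz_on_continuous_on[OF f] by (simp add: continuous_on_eq_continuous_at)
  have "f (B ** Xbar) + ubar \<bullet> (y - B ** Xbar) \<le> f y" for y
  proof (rule tendsto_upperbound)
    show "(\<lambda>i. f (B ** X (r i) - \<mu> (r i) *\<^sub>R u (r i))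
        + u (r i) \<bullet> (y - (B ** X (r i) - \<mu> (r i) *\<^sub>R u (r i))))
        \<longlonglongrightarrow> f (B ** Xbar) + ubar \<bullet> (y - B ** Xbar)"
      by (intro tendsto_intros isCont_tendsto_compose[OF f_cont] p ur)
    show "\<forall>\<^sub>F i in sequentially. f (B ** X (r i) - \<mu> (r i) *\<^sub>R u (r i))
        + u (r i) \<bullet> (y - (B ** X (r i) - \<mu> (r i) *\<^sub>R u (r i))) \<le> f y"
      using u unfolding convex_subdifferential_def by (intro always_eventually) blast
  qed simp
  then have "ubar \<in> convex_subdifferential f (B ** Xbar)"
    by (simp add: convex_subdifferential_def)
  from clarke_subdifferential_objective[OF this h(1)]
  have G: "transpose B ** ubar + gradient h Xbar \<in> clarke_subdifferential (objective f h B) Xbar" .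
  have "isCont (gradient h) Xbar"
    using lipschitz_on_continuous_on[OF h(2)] by (simp add: continuous_on_eq_continuous_at)
  then have "(\<lambda>i. transpose B ** u (r i) + gradient h (X (r i)))
      \<longlonglongrightarrow> transpose B ** ubar + gradient h Xbar"
    by (intro tendsto_intros matrix_mult.tendsto ur isCont_tendsto_compose[OF _ Xr])
  from tendsto_proj_tangent[OF Xr this]
  have "proj_tangent Xbar (transpose B ** ubar + gradient h Xbar) = 0"
    using LIMSEQ_subseq_LIMSEQ[OF V r(1)] by (intro LIMSEQ_unique) (auto simp: o_def)
  moreover have "Xbar \<in> stiefel"
    using closed_sequentially[OF closed_stiefel X(1) X(2)] by blast
  ultimately show ?thesis
    unfolding first_order_stationary_def using G by (metis image_eqI)
qed

section \<open>The smoothing parameters\<close>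

text \<open>
  At every index \<open>k\<close> the current parameter was set at some index not exceeding \<open>k\<close>, so it is at least
  \<open>\<mu> 0 / k powr \<sigma>\<close>; a reset therefore can only lower it.
\<close>

lemma smoothing_parameter_bounds:
  fixes \<mu> :: "nat \<Rightarrow> real"
  assumes "0 < \<mu> 0" and "0 < \<sigma>"
    and step: "\<And>k. \<mu> (Suc k) = \<mu> k \<or> \<mu> (Suc k) = \<mu> 0 / real (k + 1) powr \<sigma>"
  shows smoothing_parameter_pos: "0 < \<mu> k"
    and smoothing_parameter_Suc_le: "\<mu> (Suc k) \<le> \<mu> k"
proof -
  (* At index 0 the lower bound is 0, since 0 powr \<sigma> = 0 and division by 0 gives 0. *)
  have lb: "0 < \<mu> k \<and> \<mu> 0 / real k powr \<sigma> \<le> \<mu> k" for k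
  proof (induction k)
    case (Suc k)
    show ?case
    proof (cases "k = 0")
      case True
      then show ?thesis using step[of 0] assms(1) by auto
    next
      case False
      have "\<mu> 0 / real (Suc k) powr \<sigma> \<le> \<mu> 0 / real k powr \<sigma>"
        using False assms by (intro divide_left_mono powr_mono2) auto
      moreover have "0 < \<mu> 0 / real (Suc k) powr \<sigma>" using assms by simp
      ultimately show ?thesis using step[of k] Suc by auto
    qed
  qed (use assms in simp)
  then show "0 < \<mu> k" by blast
  show "\<mu> (Suc k) \<le> \<mu> k"
  proof (cases "k = 0")
    case False
    then have "\<mu> 0 / real (Suc k) powr \<sigma> \<le> \<mu> 0 / real k powr \<sigma>"
      using assms by (intro divide_left_mono powr_mono2) auto
    then show ?thesis using step[of k] lb[of k] by auto
  qed (use step[of 0] in auto)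
qed

text \<open>
  The parameter decreases, and directly after each of infinitely many changes it equals the
  prescribed null sequence.
\<close>

lemma smoothing_parameter_tendsto_0:
  fixes \<mu> :: "nat \<Rightarrow> real" and r :: "nat \<Rightarrow> nat"
  assumes "0 < \<mu> 0" and "0 < \<sigma>"
    and step: "\<And>k. \<mu> (Suc k) = \<mu> k \<or> \<mu> (Suc k) = \<mu> 0 / real (k + 1) powr \<sigma>"
    and r: "strict_mono r" "\<And>i. \<mu> (Suc (r i)) \<noteq> \<mu> (r i)"
  shows "\<mu> \<longlonglongrightarrow> 0"
proof -
  have dec: "decseq \<mu>"
    by (simp add: decseq_Suc_iff smoothing_parameter_Suc_le[OF assms(1-3)])
  moreover have "0 \<le> \<mu> k" for k
    using smoothing_parameter_pos[OF assms(1-3), of k] by simp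
  ultimately obtain m where m: "\<mu> \<longlonglongrightarrow> m" using decseq_convergent[of \<mu> 0] by blast
  have "(\<lambda>i. \<mu> (Suc (r i))) \<longlonglongrightarrow> m"
    using LIMSEQ_subseq_LIMSEQ[OF LIMSEQ_Suc[OF m] r(1)] by (simp add: o_def)
  moreover have "(\<lambda>i. \<mu> (Suc (r i))) \<longlonglongrightarrow> 0"
  proof -
    have "\<mu> (Suc (r i)) = \<mu> 0 / real (r i + 1) powr \<sigma>" for i using step[of "r i"] r(2)[of i] by auto
    moreover have "(\<lambda>k. \<mu> 0 / real (k + 1) powr \<sigma>) \<longlonglongrightarrow> 0"
    proof -
      have "filterlim (\<lambda>k. real (k + 1)) at_top sequentially"
        using filterlim_compose[OF filterlim_real_sequentially filterlim_Suc] by simp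
      from tendsto_mult[OF tendsto_const tendsto_neg_powr[OF _ this]]
      have "(\<lambda>k. \<mu> 0 * real (k + 1) powr - \<sigma>) \<longlonglongrightarrow> \<mu> 0 * 0"
        using \<open>0 < \<sigma>\<close> by simp
      then show ?thesis by (simp add: powr_minus_divide)
    qed
    ultimately show ?thesis
      using LIMSEQ_subseq_LIMSEQ[OF _ r(1), of "\<lambda>k. \<mu> 0 / real (k + 1) powr \<sigma>" 0]
      by (simp add: o_def)
  qed
  ultimately have "m = 0" by (rule LIMSEQ_unique)
  with m show ?thesis by simp
qed

section \<open>Convergence of the method\<close>

theorem theorem4p8:
  fixes f :: "real^'p^'q \<Rightarrow> real"
    and h :: "real^'p^'n \<Rightarrow> real"
    and B :: "real^'n^'q"
    and L\<^sub>f L\<^sub>h \<sigma> \<alpha> \<eta> :: real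
    and X V :: "nat \<Rightarrow> real^'p^'n"
    and \<tau> \<mu> :: "nat \<Rightarrow> real"
    and A :: "nat set"
    and Xbar :: "real^'p^'n"
  assumes "CARD('p) \<le> CARD('n)"
    and "B \<noteq> 0"
    and "convex_on UNIV f"
    and "L\<^sub>f-lipschitz_on UNIV f"
    and "\<And>Y. h differentiable (at Y)"
    and "L\<^sub>h-lipschitz_on UNIV (gradient h)"
    and "0 < \<sigma>" and "\<sigma> < 1" and "0 < \<alpha>" and "0 < \<eta>" and "\<eta> < 1"
    and "srgd_sequence f h B L\<^sub>f L\<^sub>h \<sigma> \<alpha> \<eta> X V \<tau> \<mu>"
    and "A = {k. \<mu> (Suc k) \<noteq> \<mu> k}"
    and "accumulation_point_along X A Xbar"
  shows "first_order_stationary (objective f h B) Xbar"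
proof -
  note B = assms(2) and f = assms(3,4) and h = assms(5,6) and \<sigma> = assms(7)
    and \<alpha> = assms(9) and \<eta> = assms(10,11)
  let ?s = "spectral_norm B"
  define G where "G k Y = smoothed_objective f h B Y (\<mu> k)" for k Y
  define M where "M k = ?s\<^sup>2 / \<mu> k + L\<^sub>h" for k
  have X0: "X 0 \<in> stiefel" and \<mu>0: "0 < \<mu> 0"
    using assms(12) by (simp_all add: srgd_sequence_def)
  have run: "V k = proj_tangent (X k) (gradient (G k) (X k)) \<and>
      (\<exists>j. sufficient_decrease (G k) (X k) (V k) (\<eta> ^ j * inverse (M k)) \<and>
        (\<forall>i<j. \<not> sufficient_decrease (G k) (X k) (V k) (\<eta> ^ i * inverse (M k))) \<and>
        \<tau> k = \<eta> ^ j * inverse (M k)) \<and>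
      X (Suc k) = retr (X k) (- (\<tau> k *\<^sub>R V k)) \<and>
      \<mu> (Suc k) =
        (if smoothed_objective f h B (X (Suc k)) (\<mu> k) + L\<^sub>f\<^sup>2 / 2 * \<mu> k
              - smoothed_objective f h B (X k) (\<mu> (k - 1)) - L\<^sub>f\<^sup>2 / 2 * \<mu> (k - 1)
            \<le> - \<alpha> * (\<mu> k)\<^sup>2
         then \<mu> k else \<mu> 0 / real (k + 1) powr \<sigma>)" for k
    using assms(12) unfolding srgd_sequence_def Let_def G_def M_def by blast
  have \<mu>_step: "\<mu> (Suc k) = \<mu> k \<or> \<mu> (Suc k) = \<mu> 0 / real (k + 1) powr \<sigma>" for k
    using run[of k] by presburger
  have \<mu>_pos: "0 < \<mu> k" and \<mu>_dec: "\<mu> (Suc k) \<le> \<mu> k" for k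
    using smoothing_parameter_bounds[OF \<mu>0 \<sigma> \<mu>_step] by blast+
  have Lh: "0 \<le> L\<^sub>h" by (rule lipschitz_on_nonneg[OF h(2)])
  have M_pos: "0 < M k" for k
    using \<mu>_pos[of k] spectral_norm_pos[OF B] Lh by (simp add: M_def add_pos_nonneg)
  have X: "X k \<in> stiefel" for k
  proof (induction k)
    case (Suc k)
    have "X (Suc k) = retr (X k) (- (\<tau> k *\<^sub>R proj_tangent (X k) (gradient (G k) (X k))))"
      using run[of k] by simp
    then show ?case
      using retr_in_stiefel[OF Suc scaled_proj_tangent_tangent[OF Suc]] by simp
  qed (rule X0)
  have "\<exists>u. \<forall>k. u k \<in> convex_subdifferential f (B ** X k - \<mu> k *\<^sub>R u k)"
    by (rule choice) (use proximal_point_exists[OF f \<mu>_pos] in blast)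
  then obtain u where u: "\<And>k. u k \<in> convex_subdifferential f (B ** X k - \<mu> k *\<^sub>R u k)"
    by blast
  define g where "g k = transpose B ** u k + gradient h (X k)" for k
  have V: "V k = proj_tangent (X k) (g k)" for k
    using run[of k] gradient_eqI[OF GDERIV_smoothed_objective[OF f h(1) \<mu>_pos u], of k]
    unfolding G_def g_def by simp
  have descent: "G k Y \<le> G k (X k) + g k \<bullet> (Y - X k) + M k / 2 * (norm (Y - X k))\<^sup>2" for k Y
    unfolding G_def g_def M_def by (rule smoothed_objective_upper_bound[OF f h \<mu>_pos u])
  (* A bound for all gradients: subgradients of f are bounded by the Lipschitz constant, and the
     gradient of h is bounded on the Stiefel manifold, whose points all have the norm of the
     identity matrix. *)
  define C where "C = ?s * L\<^sub>f + (norm (gradient h 0) + L\<^sub>h * norm (mat 1 :: real^'p^'p))"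
  have C: "norm (g k) \<le> C" for k
  proof -
    have "norm (transpose B ** u k) \<le> ?s * norm (u k)"
      by (rule spectral_norm_transpose_mult_le)
    also have "\<dots> \<le> ?s * L\<^sub>f"
      by (intro mult_left_mono convex_subdifferential_norm_le[OF u f(2)] spectral_norm_nonneg)
    finally have 1: "norm (transpose B ** u k) \<le> ?s * L\<^sub>f" .
    have "norm (gradient h (X k) - gradient h 0) \<le> L\<^sub>h * norm (mat 1 :: real^'p^'p)"
      using lipschitz_onD[OF h(2), of "X k" 0] norm_stiefel[OF X] by (simp add: dist_norm)
    then have "norm (gradient h (X k)) \<le> norm (gradient h 0) + L\<^sub>h * norm (mat 1 :: real^'p^'p)"
      using norm_triangle_sub[of "gradient h (X k)" "gradient h 0"] by linarith
    then show ?thesis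
      unfolding g_def C_def using 1 norm_triangle_le add_mono by blast
  qed
  have C0: "0 \<le> C" using C[of 0] norm_ge_zero order_trans by blast
  have \<tau>: "\<eta> / (C + 4 * M k) \<le> \<tau> k" for k
  proof -
    obtain j where j: "\<tau> k = \<eta> ^ j * inverse (M k)"
      "\<And>i. i < j \<Longrightarrow> \<not> sufficient_decrease (G k) (X k) (V k) (\<eta> ^ i * inverse (M k))"
      using run[of k] by blast
    show ?thesis
      unfolding j(1)
      by (rule backtracking_step_lower_bound[OF X C descent M_pos \<eta>]) (use j(2) V in auto)
  qed
  have small: "(norm (V k))\<^sup>2 \<le> 2 * \<alpha> / \<eta> * \<mu> k * (C * \<mu> k + 4 * (?s\<^sup>2 + L\<^sub>h * \<mu> k))"
    if k: "\<mu> (Suc k) \<noteq> \<mu> k" for k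
  proof -
    have "G k (X (Suc k)) + L\<^sub>f\<^sup>2 / 2 * \<mu> k
        - smoothed_objective f h B (X k) (\<mu> (k - 1)) - L\<^sub>f\<^sup>2 / 2 * \<mu> (k - 1) > - \<alpha> * (\<mu> k)\<^sup>2"
      using run[of k] k unfolding G_def by (metis not_le)
    moreover have "G k (X (Suc k)) \<le> G k (X k) - \<tau> k / 2 * (norm (V k))\<^sup>2"
      using run[of k] unfolding sufficient_decrease_def by auto
    moreover have "G k (X k) + L\<^sub>f\<^sup>2 / 2 * \<mu> k
        \<le> smoothed_objective f h B (X k) (\<mu> (k - 1)) + L\<^sub>f\<^sup>2 / 2 * \<mu> (k - 1)"
      using moreau_env_antimono_param[OF f \<mu>_pos[of k], of "\<mu> (k - 1)" "B ** X k"] \<mu>_dec[of "k - 1"]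
      (* For k = 0 truncated subtraction makes the two parameters equal. *)
      by (cases k) (simp_all add: G_def smoothed_objective_def)
    (* The failed progress test against the line search and the monotonicity in the smoothing parameter. *)
    ultimately have "\<tau> k / 2 * (norm (V k))\<^sup>2 \<le> \<alpha> * (\<mu> k)\<^sup>2" by linarith
    moreover have "\<eta> / (C + 4 * M k) / 2 * (norm (V k))\<^sup>2 \<le> \<tau> k / 2 * (norm (V k))\<^sup>2"
      using \<tau>[of k] by (intro mult_right_mono divide_right_mono) auto
    ultimately have "\<eta> / (C + 4 * M k) / 2 * (norm (V k))\<^sup>2 \<le> \<alpha> * (\<mu> k)\<^sup>2" by linarith
    moreover have "0 < C + 4 * M k" using C0 M_pos[of k] by simp
    ultimately have "(norm (V k))\<^sup>2 \<le> 2 * \<alpha> / \<eta> * (\<mu> k)\<^sup>2 * (C + 4 * M k)"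
      using \<eta> by (simp add: field_simps)
    also have "\<dots> = 2 * \<alpha> / \<eta> * \<mu> k * (\<mu> k * (C + 4 * M k))"
      by (simp add: power2_eq_square)
    also have "\<mu> k * (C + 4 * M k) = C * \<mu> k + 4 * (?s\<^sup>2 + L\<^sub>h * \<mu> k)"
      using \<mu>_pos[of k] by (simp add: M_def field_simps)
    finally show ?thesis .
  qed
  obtain r where r: "strict_mono r" "range r \<subseteq> A" "(X \<circ> r) \<longlonglongrightarrow> Xbar"
    using assms(14) unfolding accumulation_point_along_def by blast
  have rA: "\<mu> (Suc (r i)) \<noteq> \<mu> (r i)" for i using r(2) assms(13) by auto
  have "\<mu> \<longlonglongrightarrow> 0" by (rule smoothing_parameter_tendsto_0[OF \<mu>0 \<sigma> \<mu>_step r(1) rA])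
  then have \<mu>_lim: "(\<lambda>i. \<mu> (r i)) \<longlonglongrightarrow> 0"
    using LIMSEQ_subseq_LIMSEQ[OF _ r(1)] by (force simp: o_def)
  have "(\<lambda>i. 2 * \<alpha> / \<eta> * \<mu> (r i) * (C * \<mu> (r i) + 4 * (?s\<^sup>2 + L\<^sub>h * \<mu> (r i))))
      \<longlonglongrightarrow> 2 * \<alpha> / \<eta> * 0 * (C * 0 + 4 * (?s\<^sup>2 + L\<^sub>h * 0))"
    by (intro tendsto_intros \<mu>_lim)
  then have "(\<lambda>i. 2 * \<alpha> / \<eta> * \<mu> (r i) * (C * \<mu> (r i) + 4 * (?s\<^sup>2 + L\<^sub>h * \<mu> (r i)))) \<longlonglongrightarrow> 0"
    by simp
  then have "(\<lambda>i. (norm (V (r i)))\<^sup>2) \<longlonglongrightarrow> 0"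
    by (rule tendsto_sandwich[OF _ _ tendsto_const, rotated 2]) (use small[OF rA] in auto)
  from tendsto_real_sqrt[OF this] have "(\<lambda>i. V (r i)) \<longlonglongrightarrow> 0"
    by (simp add: tendsto_norm_zero_iff)
  then have "(\<lambda>i. proj_tangent (X (r i)) (transpose B ** u (r i) + gradient h (X (r i)))) \<longlonglongrightarrow> 0"
    by (simp add: V g_def)
  moreover have "(\<lambda>i. X (r i)) \<longlonglongrightarrow> Xbar" using r(3) by (simp add: o_def)
  ultimately show ?thesis
    by (intro first_order_stationary_limit[OF f(2) h X _ \<mu>_lim u])
qed

end
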